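(* Let $\varphi:[0,\infty)\rightarrow(0,\infty)$ be a non-decreasing function. Then the following are equivalent. (i) The series $\sum_{n=1}^\infty \frac{1}{\varphi(n)}$ diverges. (ii) For every continuous function $F:\mathbb{R}^2\rightarrow\mathbb{R}$ for which there exists a continuous function $\psi:\mathbb{R}\rightarrow(0,\infty)$ such that $$|F(x,y)-F(x,z)|<(z-y)\,\psi(x)\,\varphi(|\ln(z-y)|)$$ holds for all real numbers $x,y,z$ such that $y<z\leq y+1$, the initial value problem $y'=F(x,y)$, $y(0)=y_0$ has, for every $y_0\in\mathbb{R}$, a unique local solution. (iii) For every continuous function $F:\mathbb{R}^2\rightarrow\mathbb{R}$ for which there exists a continuous function $\psi:\mathbb{R}\rightarrow(0,\infty)$ such that $$|F(x,y)|<|y|\,\psi(x)\,\varphi(\ln(2+|y|))$$ holds for all $x$ and $y$, every local solution of the initial value problem $y'=F(x,y)$, $y(0)=y_0$, where $y_0\in\mathbb{R}$ is arbitrary, can be continued to a global solution.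
   Context: $\ln$ denotes the natural logarithm. A local solution of the initial value problem $y'=F(x,y)$, $y(0)=y_0$ is a differentiable function $y$ defined on an open interval containing $0$ with $y(0)=y_0$ and $y'(x)=F(x,y(x))$ for all $x$ in that interval. A global solution is a solution defined on all of $\mathbb{R}$. Having a unique local solution means that a local solution exists and any two local solutions coincide on some open interval containing $0$.
   Formalization: In (iii) the strict inequality |F(x,y)| < |y| ψ(x) φ(ln(2+|y|)) is required only for y ≠ 0; at y = 0 it would read |F(x,0)| < 0, making (iii) vacuous and the equivalence false (e.g. φ(t) = e^t). *)

theory Defs
  imports "HOL-Analysis.Analysis"
begin

definition open_interval_around_0 :: "real set \<Rightarrow> bool" where
  "open_interval_around_0 I \<longleftrightarrow> open I \<and> is_interval I \<and> 0 \<in> I"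

text \<open>
  A partial function on \<open>I\<close> is represented by a total function whose values outside \<open>I\<close> are
  irrelevant. As \<open>I\<close> is open, the derivative at a point of \<open>I\<close> depends only on the values on \<open>I\<close>.
\<close>

definition solves_ivp_on ::
  "(real \<times> real \<Rightarrow> real) \<Rightarrow> real \<Rightarrow> real set \<Rightarrow> (real \<Rightarrow> real) \<Rightarrow> bool" where
  "solves_ivp_on F y0 I y \<longleftrightarrow>
     y 0 = y0 \<and> (\<forall>x\<in>I. (y has_real_derivative F (x, y x)) (at x))"

definition local_solution ::
  "(real \<times> real \<Rightarrow> real) \<Rightarrow> real \<Rightarrow> real set \<Rightarrow> (real \<Rightarrow> real) \<Rightarrow> bool" where
  "local_solution F y0 I y \<longleftrightarrow> open_interval_around_0 I \<and> solves_ivp_on F y0 I y"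

definition global_solution :: "(real \<times> real \<Rightarrow> real) \<Rightarrow> real \<Rightarrow> (real \<Rightarrow> real) \<Rightarrow> bool" where
  "global_solution F y0 y \<longleftrightarrow> solves_ivp_on F y0 UNIV y"

definition has_unique_local_solution :: "(real \<times> real \<Rightarrow> real) \<Rightarrow> real \<Rightarrow> bool" where
  "has_unique_local_solution F y0 \<longleftrightarrow>
     (\<exists>I y. local_solution F y0 I y) \<and>
     (\<forall>I y J z. local_solution F y0 I y \<longrightarrow> local_solution F y0 J z \<longrightarrow>
        (\<exists>K. open_interval_around_0 K \<and> K \<subseteq> I \<inter> J \<and> (\<forall>x\<in>K. y x = z x)))"

definition modulus_condition ::
  "(real \<Rightarrow> real) \<Rightarrow> (real \<times> real \<Rightarrow> real) \<Rightarrow> bool" where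
  "modulus_condition \<phi> F \<longleftrightarrow>
     (\<exists>\<psi>. continuous_on UNIV \<psi> \<and> (\<forall>x. \<psi> x > 0) \<and>
        (\<forall>x y z. y < z \<and> z \<le> y + 1 \<longrightarrow>
           \<bar>F (x, y) - F (x, z)\<bar> < (z - y) * \<psi> x * \<phi> \<bar>ln (z - y)\<bar>))"

text \<open>
  The strict inequality is required for \<open>y \<noteq> 0\<close> only, since at \<open>y = 0\<close> it would read
  \<open>\<bar>F (x, 0)\<bar> < 0\<close> and no \<open>F\<close> would satisfy the condition. For continuous \<open>F\<close> and nondecreasing
  \<open>\<phi> > 0\<close> this is equivalent to demanding the non-strict inequality for all \<open>x\<close> and \<open>y\<close>: replace
  \<open>\<psi>\<close> by \<open>2\<psi>\<close> in one direction, and let \<open>y\<close> tend to \<open>0\<close> in the other.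
\<close>

definition growth_condition ::
  "(real \<Rightarrow> real) \<Rightarrow> (real \<times> real \<Rightarrow> real) \<Rightarrow> bool" where
  "growth_condition \<phi> F \<longleftrightarrow>
     (\<exists>\<psi>. continuous_on UNIV \<psi> \<and> (\<forall>x. \<psi> x > 0) \<and>
        (\<forall>x y. y \<noteq> 0 \<longrightarrow> \<bar>F (x, y)\<bar> < \<bar>y\<bar> * \<psi> x * \<phi> (ln (2 + \<bar>y\<bar>))))"

end

theory Submission
  imports Defs "HOL-Complex_Analysis.Great_Picard"
begin

text \<open>
  Both problems become the same question after a logarithmic change of variable. If \<open>u\<close> is the
  difference of two solutions, then the modulus condition bounds the speed of \<open>s = - ln \<bar>u\<bar>\<close> by a
  multiple of \<open>\<phi> s\<close> as long as \<open>\<bar>u\<bar> \<le> 1\<close>; if \<open>y\<close> is a solution, then the growth condition bounds the speed of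
  \<open>s = ln (2 + \<bar>y\<bar>)\<close> in the same way. Uniqueness fails if the first \<open>s\<close> can come from infinity
  (two solutions separate), continuation fails if the second \<open>s\<close> can reach infinity, in both cases
  in finite time. For \<open>s' = \<phi> s\<close> the time to infinity is the integral of \<open>1 / \<phi>\<close>, which is finite
  if and only if the series \<open>\<Sum>1/\<phi>(n)\<close> converges.

  Since \<open>\<phi>\<close> may jump, it is replaced by a continuous majorant \<open>\<beta>\<close> or minorant \<open>\<alpha>\<close> whose series
  behaves in the same way (\<open>continuous_majorant\<close>, \<open>continuous_minorant\<close>).

  If the series diverges, the antiderivative \<open>\<Phi>\<close> of \<open>1 / \<beta>\<close> tends to infinity but changes at a
  bounded rate along \<open>s\<close>. For differences of solutions this excludes separation
  (\<open>Osgood_vanishing\<close>). For solutions it provides a Lyapunov function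
  (\<open>divergence_imp_Lyapunov\<close>) and thereby a priori bounds, with which Peano's theorem is applied
  on successive unit intervals (\<open>Lyapunov_continuation\<close>).

  If the series converges, \<open>y' = \<bar>y\<bar> * \<alpha> (ln (2 + \<bar>y\<bar>))\<close> blows up
  (\<open>convergence_imp_blow_up\<close>). A counterexample to uniqueness is modelled on
  \<open>y' = y * \<alpha> (- ln y)\<close>, but a right-hand side must be compatible with the modulus condition at
  all pairs of points. This holds if it is nondecreasing and its quotient by \<open>y\<close> is nonincreasing
  (\<open>star_shaped_modulus\<close>), which an exponential average of \<open>1 / \<alpha>\<close> achieves
  (\<open>convergence_imp_nonunique\<close>).
\<close>

section \<open>Peano's existence theorem\<close>

text \<open>
  Derivatives are taken within \<open>S\<close>, hence one-sided at the ends of a closed interval, so that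
  solutions on adjacent closed intervals can be glued.
\<close>

definition solves_on :: "(real \<times> real \<Rightarrow> real) \<Rightarrow> real set \<Rightarrow> (real \<Rightarrow> real) \<Rightarrow> bool" where
  "solves_on F S y \<longleftrightarrow> (\<forall>x\<in>S. (y has_real_derivative F (x, y x)) (at x within S))"

lemma lipschitz_on_indefinite_integral:
  fixes h :: "real \<Rightarrow> real"
  assumes h: "continuous_on UNIV h" and M: "\<And>t. \<bar>h t\<bar> \<le> M"
  shows "M-lipschitz_on UNIV (\<lambda>x. integral {a..x} h)"
proof (rule lipschitz_onI)
  show M0: "0 \<le> M"
    using M[of 0] by linarith
  have int: "h integrable_on {s..t}" for s t
    by (rule integrable_continuous_real) (rule continuous_on_subset[OF h subset_UNIV])
  have bound: "\<bar>integral {s..t} h\<bar> \<le> M * (t - s)" if "s \<le> t" for s t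
    using integral_bound[OF that continuous_on_subset[OF h subset_UNIV]] M by simp
  have *: "\<bar>integral {a..t} h - integral {a..s} h\<bar> \<le> M * (t - s)" if "s \<le> t" for s t
  proof (cases "a \<le> s")
    case True
    have "integral {a..s} h + integral {s..t} h = integral {a..t} h"
      using True that int by (intro Henstock_Kurzweil_Integration.integral_combine) auto
    then show ?thesis
      using bound[OF that] by simp
  next
    case sa: False
    then have [simp]: "integral {a..s} h = 0"
      by simp
    show ?thesis
    proof (cases "a \<le> t")
      case True
      have "\<bar>integral {a..t} h\<bar> \<le> M * (t - a)"
        by (rule bound[OF True])
      also have "\<dots> \<le> M * (t - s)"
        using sa M0 by (intro mult_left_mono) auto
      finally show ?thesis
        by simp
    next
      case False
      then show ?thesis
        using M0 that by simp
    qed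
  qed
  show "dist (integral {a..x} h) (integral {a..y} h) \<le> M * dist x y" for x y
    using *[of x y] *[of y x] by (cases "x \<le> y") (auto simp: dist_real_def abs_minus_commute)
qed

lemma continuous_on_compose_curve:
  fixes F :: "real \<times> real \<Rightarrow> real"
  assumes "continuous_on UNIV F" "continuous_on S y"
  shows "continuous_on S (\<lambda>t. F (t, y t))"
  by (rule continuous_on_compose2[OF assms(1)]) (auto intro!: continuous_intros assms(2))

text \<open>
  Tonelli's device for Peano's theorem: when the right-hand side only looks at the value
  \<open>\<delta>\<close> earlier, iterating the integral operator stabilises. Each iteration settles the values on a
  further interval of length \<open>\<delta>\<close>, so on \<open>{..b}\<close> finitely many iterations give an exact solution.
\<close>

lemma delayed_equation_solvable:
  fixes F :: "real \<times> real \<Rightarrow> real"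
  assumes F: "continuous_on UNIV F" and M: "\<And>p. \<bar>F p\<bar> \<le> M" and d: "\<delta> > 0"
  obtains y where "M-lipschitz_on UNIV y"
    and "\<And>x. x \<le> b \<Longrightarrow> y x = y0 + integral {a..x} (\<lambda>t. F (t, y (t - \<delta>)))"
proof -
  define step where "step = (\<lambda>g x. y0 + integral {a..x} (\<lambda>t. F (t, g (t - \<delta>))))"
  define f where "f = (\<lambda>k. (step ^^ k) (\<lambda>_. y0))"
  have f_Suc: "f (Suc k) = step (f k)" for k
    by (simp add: f_def)
  have M0: "0 \<le> M"
    using M[of undefined] by linarith
  have lip: "M-lipschitz_on UNIV (f k)" for k
  proof (induction k)
    case 0
    then show ?case
      using M0 by (simp add: f_def lipschitz_on_def)
  next
    case (Suc k)
    have "continuous_on UNIV (\<lambda>t. f k (t - \<delta>))"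
      by (rule continuous_on_compose2[OF lipschitz_on_continuous_on[OF Suc]])
         (auto intro!: continuous_intros)
    then have "continuous_on UNIV (\<lambda>t. F (t, f k (t - \<delta>)))"
      by (rule continuous_on_compose_curve[OF F])
    then have "M-lipschitz_on UNIV (\<lambda>x. integral {a..x} (\<lambda>t. F (t, f k (t - \<delta>))))"
      using M by (rule lipschitz_on_indefinite_integral)
    then show ?case
      unfolding f_Suc step_def lipschitz_on_def by (simp add: dist_real_def)
  qed
  have stable: "f (Suc k) x = f k x" if "x < a + k * \<delta> \<or> x < a" for k x
    using that
  proof (induction k arbitrary: x)
    case 0
    then show ?case
      by (simp add: f_def step_def)
  next
    case (Suc k)
    have "integral {a..x} (\<lambda>t. F (t, f (Suc k) (t - \<delta>))) = integral {a..x} (\<lambda>t. F (t, f k (t - \<delta>)))"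
    proof (rule Henstock_Kurzweil_Integration.integral_cong)
      fix t assume "t \<in> {a..x}"
      then have "t - \<delta> < a + k * \<delta> \<or> t - \<delta> < a"
        using Suc.prems d by (auto simp: algebra_simps)
      then show "F (t, f (Suc k) (t - \<delta>)) = F (t, f k (t - \<delta>))"
        using Suc.IH by simp
    qed
    then show ?case
      by (simp add: f_Suc step_def)
  qed
  obtain k :: nat where k: "(b - a) / \<delta> < k"
    using reals_Archimedean2 by blast
  show thesis
  proof (rule that)
    show "M-lipschitz_on UNIV (f k)"
      by (rule lip)
    show "f k x = y0 + integral {a..x} (\<lambda>t. F (t, f k (t - \<delta>)))" if "x \<le> b" for x
    proof -
      have "b - a < k * \<delta>"
        using k d by (simp add: pos_divide_less_eq)
      then have "f (Suc k) x = f k x"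
        using that by (intro stable) auto
      then show ?thesis
        by (simp add: f_Suc step_def)
    qed
  qed
qed

text \<open>
  The solutions with delay \<open>1 / (n + 1)\<close> share the Lipschitz constant \<open>M\<close>, so by Arzela-Ascoli some
  subsequence converges uniformly; as the delay tends to zero, the integral equation passes to the
  limit by dominated convergence.
\<close>

lemma bounded_Peano:
  fixes F :: "real \<times> real \<Rightarrow> real"
  assumes F: "continuous_on UNIV F" and M: "\<And>p. \<bar>F p\<bar> \<le> M"
  obtains y where "y a = y0" "solves_on F {a..b} y"
proof -
  define \<delta> where "\<delta> = (\<lambda>n. 1 / real (Suc n))"
  have \<delta>: "\<delta> n > 0" for n
    by (simp add: \<delta>_def)
  have \<delta>0: "\<delta> \<longlonglongrightarrow> 0"
    unfolding \<delta>_def by (rule LIMSEQ_Suc[OF lim_1_over_n])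
  have "\<exists>y. M-lipschitz_on UNIV y \<and>
          (\<forall>x\<le>b. y x = y0 + integral {a..x} (\<lambda>t. F (t, y (t - \<delta> n))))" for n
    using delayed_equation_solvable[OF F M \<delta>[of n], of b y0 a] by metis
  then obtain y where lip: "\<And>n. M-lipschitz_on UNIV (y n)"
    and y: "\<And>n x. x \<le> b \<Longrightarrow> y n x = y0 + integral {a..x} (\<lambda>t. F (t, y n (t - \<delta> n)))"
    by metis
  have M0: "0 \<le> M"
    using M[of undefined] by linarith
  have lipD: "\<bar>y n s - y n t\<bar> \<le> M * \<bar>s - t\<bar>" for n s t
    using lipschitz_onD[OF lip, of s t n] by (simp add: dist_real_def)
  have ybound: "norm (y n x) \<le> \<bar>y0\<bar> + M * (b - a)" if x: "x \<in> {a..b}" for n x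
  proof -
    have "y n a = y0"
      using y[of a n] x by simp
    moreover have "M * \<bar>x - a\<bar> \<le> M * (b - a)"
      using x M0 by (intro mult_left_mono) auto
    ultimately show ?thesis
      using lipD[of n x a] by simp
  qed
  have equi: "\<exists>d>0. \<forall>n t. t \<in> {a..b} \<and> norm (x - t) < d \<longrightarrow> norm (y n x - y n t) < e"
    if "x \<in> {a..b}" "0 < e" for x e
  proof (intro exI conjI allI impI)
    show "0 < e / (M + 1)"
      using that M0 by simp
    fix n t assume "t \<in> {a..b} \<and> norm (x - t) < e / (M + 1)"
    then have "(M + 1) * \<bar>x - t\<bar> < e"
      using M0 by (simp add: pos_less_divide_eq mult.commute)
    then show "norm (y n x - y n t) < e"
      using lipD[of n x t] by (simp add: algebra_simps)
  qed
  obtain g k where g: "continuous_on {a..b} g" and k: "strict_mono (k :: nat \<Rightarrow> nat)"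
    and conv: "\<And>e. 0 < e \<Longrightarrow> \<exists>N. \<forall>n x. n \<ge> N \<and> x \<in> {a..b} \<longrightarrow> norm (y (k n) x - g x) < e"
    using Arzela_Ascoli[OF compact_Icc ybound equi] by blast
  have lim: "(\<lambda>n. y (k n) x) \<longlonglongrightarrow> g x" if "x \<in> {a..b}" for x
    using conv that unfolding LIMSEQ_iff by meson
  have lim_delayed: "(\<lambda>n. y (k n) (x - \<delta> (k n))) \<longlonglongrightarrow> g x" if x: "x \<in> {a..b}" for x
  proof -
    have "(\<lambda>n. \<delta> (k n)) \<longlonglongrightarrow> 0"
      using LIMSEQ_subseq_LIMSEQ[OF \<delta>0 k] by (simp add: o_def)
    then have "(\<lambda>n. M * \<bar>\<delta> (k n)\<bar>) \<longlonglongrightarrow> 0"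
      by (auto intro!: tendsto_eq_intros)
    then have "(\<lambda>n. y (k n) (x - \<delta> (k n)) - y (k n) x) \<longlonglongrightarrow> 0"
    proof (rule Lim_null_comparison[rotated], intro always_eventually allI)
      fix n show "norm (y (k n) (x - \<delta> (k n)) - y (k n) x) \<le> M * \<bar>\<delta> (k n)\<bar>"
        using lipD[of "k n" "x - \<delta> (k n)" x] by simp
    qed
    from tendsto_add[OF this lim[OF x]] show ?thesis
      by simp
  qed
  have g_eq: "g x = y0 + integral {a..x} (\<lambda>t. F (t, g t))" if x: "x \<in> {a..b}" for x
  proof -
    have "(\<lambda>n. integral {a..x} (\<lambda>t. F (t, y (k n) (t - \<delta> (k n)))))
            \<longlonglongrightarrow> integral {a..x} (\<lambda>t. F (t, g t))"
    proof (rule dominated_convergence(2)[where h = "\<lambda>_. M"])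
      fix n
      have "continuous_on {a..x} (\<lambda>t. y (k n) (t - \<delta> (k n)))"
        by (rule continuous_on_compose2[OF lipschitz_on_continuous_on[OF lip]])
           (auto intro!: continuous_intros)
      then show "(\<lambda>t. F (t, y (k n) (t - \<delta> (k n)))) integrable_on {a..x}"
        by (intro integrable_continuous_real continuous_on_compose_curve[OF F])
    next
      fix t assume "t \<in> {a..x}"
      then have "t \<in> {a..b}"
        using x by simp
      then have "(\<lambda>n. (t, y (k n) (t - \<delta> (k n)))) \<longlonglongrightarrow> (t, g t)"
        by (intro tendsto_intros lim_delayed)
      then show "(\<lambda>n. F (t, y (k n) (t - \<delta> (k n)))) \<longlonglongrightarrow> F (t, g t)"
        by (rule isCont_tendsto_compose[rotated])
           (use F in \<open>simp add: continuous_on_eq_continuous_at\<close>)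
    qed (use M in auto)
    then have "(\<lambda>n. y (k n) x) \<longlonglongrightarrow> y0 + integral {a..x} (\<lambda>t. F (t, g t))"
      using y[of x] x by (auto intro!: tendsto_intros)
    then show ?thesis
      using lim[OF x] LIMSEQ_unique by blast
  qed
  define Y where "Y = (\<lambda>x. y0 + integral {a..x} (\<lambda>t. F (t, g t)))"
  have "solves_on F {a..b} Y"
    unfolding solves_on_def
  proof
    fix x assume x: "x \<in> {a..b}"
    have "(Y has_real_derivative F (x, g x)) (at x within {a..b})"
      unfolding Y_def
      using integral_has_real_derivative[OF continuous_on_compose_curve[OF F g] x]
      by (auto intro!: derivative_eq_intros)
    then show "(Y has_real_derivative F (x, Y x)) (at x within {a..b})"
      using g_eq[OF x] by (simp add: Y_def)
  qed
  moreover have "Y a = y0"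
    by (simp add: Y_def)
  ultimately show thesis
    using that by blast
qed

lemma at_within_eq_bot:
  fixes x c :: real
  shows "S \<subseteq> {..c} \<Longrightarrow> c < x \<Longrightarrow> at x within S = bot"
    and "S \<subseteq> {c..} \<Longrightarrow> x < c \<Longrightarrow> at x within S = bot"
proof -
  have "at x within S = bot" if "S \<subseteq> - U" "open U" "x \<in> U" for U
    using at_within_nhd[of x U S "{}"] that by auto
  from this[of "{c<..}"] this[of "{..<c}"]
  show "S \<subseteq> {..c} \<Longrightarrow> c < x \<Longrightarrow> at x within S = bot"
    and "S \<subseteq> {c..} \<Longrightarrow> x < c \<Longrightarrow> at x within S = bot"
    by (auto simp: subset_iff not_less)
qed

lemma solves_on_cong:
  assumes "solves_on F S y" "\<And>x. x \<in> S \<Longrightarrow> z x = y x"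
  shows "solves_on F S z"
  unfolding solves_on_def
proof
  fix x assume x: "x \<in> S"
  have "(z has_real_derivative F (x, y x)) (at x within S)"
    by (rule has_field_derivative_transform_within[where d = 1 and f = y])
       (use assms x in \<open>auto simp: solves_on_def\<close>)
  then show "(z has_real_derivative F (x, z x)) (at x within S)"
    using assms(2)[OF x] by simp
qed

text \<open>
  The two pieces may overlap in \<open>c\<close> only. Away from \<open>c\<close> one of the two one-sided conditions is empty
  because the filter \<open>at x within S\<close> is trivial there.
\<close>

lemma solves_on_glue:
  assumes y: "solves_on F S y" and z: "solves_on F T z"
    and S: "S \<subseteq> {..c}" and T: "T \<subseteq> {c..}" and c: "c \<in> S" "c \<in> T" "y c = z c"
  shows "solves_on F (S \<union> T) (\<lambda>x. if x \<le> c then y x else z x)" (is "solves_on F _ ?w")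
  unfolding solves_on_def
proof
  have wS: "solves_on F S ?w"
    by (rule solves_on_cong[OF y]) (use S in auto)
  have wT: "solves_on F T ?w"
    by (rule solves_on_cong[OF z]) (use T c in auto)
  fix x assume x: "x \<in> S \<union> T"
  have "(?w has_real_derivative F (x, ?w x)) (at x within S)"
  proof (cases "x \<in> S")
    case True
    then show ?thesis
      using wS unfolding solves_on_def by blast
  next
    case False
    then have "x \<in> T" "x \<noteq> c"
      using x c by auto
    then have "c < x"
      using T by force
    then show ?thesis
      unfolding has_field_derivative_iff at_within_eq_bot(1)[OF S \<open>c < x\<close>] by simp
  qed
  moreover have "(?w has_real_derivative F (x, ?w x)) (at x within T)"
  proof (cases "x \<in> T")
    case True
    then show ?thesis
      using wT unfolding solves_on_def by blast
  next
    case False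
    then have "x \<in> S" "x \<noteq> c"
      using x c by auto
    then have "x < c"
      using S by force
    then show ?thesis
      unfolding has_field_derivative_iff at_within_eq_bot(2)[OF T \<open>x < c\<close>] by simp
  qed
  ultimately show "(?w has_real_derivative F (x, ?w x)) (at x within S \<union> T)"
    unfolding has_field_derivative_iff by (rule Lim_Un)
qed

lemma solves_on_subset:
  assumes "solves_on F T y" "S \<subseteq> T"
  shows "solves_on F S y"
  using assms DERIV_subset unfolding solves_on_def by blast

lemma solves_on_open_iff:
  assumes "open S"
  shows "solves_on F S y \<longleftrightarrow> (\<forall>x\<in>S. (y has_real_derivative F (x, y x)) (at x))"
  by (simp add: solves_on_def at_within_open[OF _ assms])

lemma solves_on_imp_continuous_on:
  assumes "solves_on F S y"
  shows "continuous_on S y"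
  by (rule DERIV_continuous_on) (use assms in \<open>auto simp: solves_on_def\<close>)

text \<open>
  Solutions of \<open>time_reversal F\<close> are the solutions of \<open>F\<close> run backwards, which reduces existence and
  continuation to the left of \<open>0\<close> to the same questions on the right.
\<close>

definition time_reversal :: "(real \<times> real \<Rightarrow> real) \<Rightarrow> real \<times> real \<Rightarrow> real" where
  "time_reversal F = (\<lambda>(x, y). - F (- x, y))"

lemma time_reversal_time_reversal [simp]: "time_reversal (time_reversal F) = F"
  by (simp add: time_reversal_def fun_eq_iff)

lemma continuous_on_time_reversal:
  assumes "continuous_on UNIV F"
  shows "continuous_on UNIV (time_reversal F)"
  unfolding time_reversal_def case_prod_unfold
  by (intro continuous_intros continuous_on_compose2[OF assms]) auto

lemma solves_on_time_reversal:
  assumes "solves_on F S y"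
  shows "solves_on (time_reversal F) (uminus ` S) (\<lambda>x. y (- x))"
  unfolding solves_on_def
proof
  fix x assume "x \<in> uminus ` S"
  then have "- x \<in> S"
    by auto
  then have "(y has_real_derivative F (- x, y (- x))) (at (- x) within uminus ` uminus ` S)"
    using assms by (simp add: solves_on_def image_image)
  moreover have "(uminus has_real_derivative - 1) (at x within uminus ` S)"
    by (auto intro!: derivative_eq_intros)
  ultimately have "(y \<circ> uminus has_real_derivative F (- x, y (- x)) * - 1) (at x within uminus ` S)"
    by (rule DERIV_image_chain)
  then
  show "((\<lambda>x. y (- x)) has_real_derivative time_reversal F (x, y (- x))) (at x within uminus ` S)"
    by (simp add: o_def time_reversal_def)
qed

lemma DERIV_bound_imp_lipschitz:
  fixes w :: "real \<Rightarrow> real"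
  assumes "convex S"
    and "\<And>x. x \<in> S \<Longrightarrow> (w has_real_derivative w' x) (at x within S)"
    and "\<And>x. x \<in> S \<Longrightarrow> \<bar>w' x\<bar> \<le> C"
    and "s \<in> S" "t \<in> S"
  shows "\<bar>w s - w t\<bar> \<le> C * \<bar>s - t\<bar>"
  using field_differentiable_bound[OF assms(1,2), of C s t] assms(3-) by simp

lemma continuous_imp_bounded_on_rectangle:
  fixes F :: "real \<times> real \<Rightarrow> real"
  assumes "continuous_on UNIV F"
  obtains M where "0 \<le> M" "\<And>x y. x \<in> {a..b} \<Longrightarrow> \<bar>y\<bar> \<le> R \<Longrightarrow> \<bar>F (x, y)\<bar> \<le> M"
proof -
  have "compact (F ` ({a..b} \<times> {-R..R}))"
    by (intro compact_continuous_image continuous_on_subset[OF assms] compact_Times) auto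
  then obtain M where "\<forall>p\<in>{a..b} \<times> {-R..R}. \<bar>F p\<bar> \<le> M"
    using compact_imp_bounded bounded_iff by (metis imageI real_norm_def)
  then have "\<bar>F (x, y)\<bar> \<le> max M 0" if "x \<in> {a..b}" "\<bar>y\<bar> \<le> R" for x y
    using that by (intro max.coboundedI1) (auto simp: abs_le_iff)
  then show thesis
    using that[of "max M 0"] by simp
qed

lemma continuous_imp_bounded_on_interval:
  fixes c :: "real \<Rightarrow> real"
  assumes "continuous_on UNIV c"
  obtains M where "0 \<le> M" "\<And>x. x \<in> {a..b} \<Longrightarrow> \<bar>c x\<bar> \<le> M"
proof -
  have "continuous_on UNIV (\<lambda>p. c (fst p))"
    by (intro continuous_on_compose2[OF assms] continuous_intros) auto
  from continuous_imp_bounded_on_rectangle[OF this, of a b 0] obtain M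
    where "0 \<le> M" "\<And>x. x \<in> {a..b} \<Longrightarrow> \<bar>c x\<bar> \<le> M"
    by (metis abs_zero fst_conv order_refl)
  then show thesis
    by (rule that)
qed

text \<open>
  Clamping both arguments to a square around the initial point makes the right-hand side bounded
  without changing it near that point.
\<close>

theorem Peano_local_existence:
  fixes F :: "real \<times> real \<Rightarrow> real"
  assumes F: "continuous_on UNIV F"
  obtains I y where "local_solution F y0 I y"
proof -
  define G where "G = (\<lambda>p. F (max (-1) (min 1 (fst p)), max (y0 - 1) (min (y0 + 1) (snd p))))"
  have G: "continuous_on UNIV G"
    unfolding G_def by (intro continuous_on_compose2[OF F] continuous_intros) auto
  obtain M where M: "\<And>x y. x \<in> {-1..1} \<Longrightarrow> \<bar>y\<bar> \<le> \<bar>y0\<bar> + 1 \<Longrightarrow> \<bar>F (x, y)\<bar> \<le> M"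
    using continuous_imp_bounded_on_rectangle[OF F] by metis
  have GM: "\<bar>G p\<bar> \<le> M" for p
    unfolding G_def by (rule M) auto
  then have GM': "\<bar>time_reversal G p\<bar> \<le> M" for p
    by (simp add: time_reversal_def case_prod_unfold)
  obtain y where y: "y 0 = y0" "solves_on G {0..1} y"
    using bounded_Peano[OF G GM] by blast
  obtain z where z: "z 0 = y0" "solves_on (time_reversal G) {0..1} z"
    using bounded_Peano[OF continuous_on_time_reversal[OF G] GM'] by blast
  have z': "solves_on G {-1..0} (\<lambda>x. z (- x))"
    using solves_on_time_reversal[OF z(2)] by simp
  define w where "w = (\<lambda>x. if x \<le> 0 then z (- x) else y x)"
  have "solves_on G ({-1..0} \<union> {0..1}) w"
    unfolding w_def by (rule solves_on_glue[OF z' y(2)]) (use y z in auto)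
  moreover have "{-1..0} \<union> {0..1} = {-1..1::real}"
    by auto
  ultimately have w: "solves_on G {-1..1} w"
    by simp
  have w0: "w 0 = y0"
    using z by (simp add: w_def)
  obtain d where d: "d > 0" "\<And>x. x \<in> {-1..1} \<Longrightarrow> \<bar>x\<bar> < d \<Longrightarrow> \<bar>w x - y0\<bar> < 1"
    using continuous_on_iff[THEN iffD1, OF solves_on_imp_continuous_on[OF w], rule_format, of 0 1] w0
    by (auto simp: dist_real_def)
  define I where "I = {- min d 1<..<min d 1}"
  have "(w has_real_derivative F (x, w x)) (at x)" if "x \<in> I" for x
  proof -
    have x: "x \<in> {-1<..<1}" "\<bar>x\<bar> < d"
      using that by (auto simp: I_def)
    have "solves_on G {-1<..<1} w"
      by (rule solves_on_subset[OF w]) auto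
    then have "(w has_real_derivative G (x, w x)) (at x)"
      using x by (simp add: solves_on_open_iff)
    moreover have "G (x, w x) = F (x, w x)"
      using d(2)[of x] x by (auto simp: G_def max_def min_def abs_less_iff)
    ultimately show ?thesis
      by simp
  qed
  moreover have "open_interval_around_0 I"
    using d by (auto simp: open_interval_around_0_def I_def is_interval_1)
  ultimately show thesis
    using that w0 by (auto simp: local_solution_def solves_ivp_on_def)
qed

section \<open>Continuation by means of Lyapunov functions\<close>

text \<open>
  The inequality says that \<open>V\<close> changes along any solution at a rate of at most \<open>c x\<close>, whatever the
  value of the solution; since \<open>V\<close> has bounded sublevel sets, no solution can escape to infinity in
  finite time.
\<close>

definition has_Lyapunov_function :: "(real \<times> real \<Rightarrow> real) \<Rightarrow> bool" where
  "has_Lyapunov_function F \<longleftrightarrow>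
     (\<exists>V V' c. (\<forall>y. (V has_real_derivative V' y) (at y)) \<and> (\<forall>B. \<exists>R. \<forall>y. V y \<le> B \<longrightarrow> \<bar>y\<bar> \<le> R) \<and>
        continuous_on UNIV c \<and> (\<forall>x y. \<bar>V' y * F (x, y)\<bar> \<le> c x))"

lemma has_Lyapunov_function_time_reversal:
  assumes "has_Lyapunov_function F"
  shows "has_Lyapunov_function (time_reversal F)"
proof -
  from assms obtain V V' c where V: "\<And>y. (V has_real_derivative V' y) (at y)"
    "\<And>B. \<exists>R. \<forall>y. V y \<le> B \<longrightarrow> \<bar>y\<bar> \<le> R"
    and c: "continuous_on UNIV c" "\<And>x y. \<bar>V' y * F (x, y)\<bar> \<le> c x"
    unfolding has_Lyapunov_function_def by blast
  have "continuous_on UNIV (\<lambda>x. c (- x))"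
    by (intro continuous_on_compose2[OF c(1)] continuous_intros) auto
  moreover have "\<bar>V' y * time_reversal F (x, y)\<bar> \<le> c (- x)" for x y
    using c(2)[of y "- x"] by (simp add: time_reversal_def)
  ultimately show ?thesis
    unfolding has_Lyapunov_function_def using V by blast
qed

text \<open>
  The factor \<open>\<kappa>\<close> makes the bound available for right-hand sides that have been cut off, with a radius
  \<open>R\<close> that does not depend on the cutoff. This avoids a circularity, as the cutoff radius is chosen to
  be this \<open>R\<close>.
\<close>

lemma Lyapunov_bound:
  assumes "has_Lyapunov_function F"
  obtains R where "\<And>\<kappa> S y x. \<lbrakk>convex S; a \<in> S; S \<subseteq> {a..b}; y a = v; \<forall>p. \<bar>\<kappa> p\<bar> \<le> (1::real);
    solves_on (\<lambda>p. \<kappa> p * F p) S y; x \<in> S\<rbrakk> \<Longrightarrow> \<bar>y x\<bar> \<le> R"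
proof -
  from assms obtain V V' c where V: "\<And>y. (V has_real_derivative V' y) (at y)"
    "\<And>B. \<exists>R. \<forall>y. V y \<le> B \<longrightarrow> \<bar>y\<bar> \<le> R"
    and c: "continuous_on UNIV c" "\<And>x y. \<bar>V' y * F (x, y)\<bar> \<le> c x"
    unfolding has_Lyapunov_function_def by blast
  obtain C where C: "0 \<le> C" "\<And>x. x \<in> {a..b} \<Longrightarrow> \<bar>c x\<bar> \<le> C"
    using continuous_imp_bounded_on_interval[OF c(1)] by metis
  obtain R where R: "\<And>y. V y \<le> V v + C * (b - a) \<Longrightarrow> \<bar>y\<bar> \<le> R"
    using V(2) by metis
  show thesis
  proof (rule that)
    fix \<kappa> :: "real \<times> real \<Rightarrow> real" and S y x
    assume S: "convex S" "a \<in> S" "S \<subseteq> {a..b}" and a: "y a = v" and \<kappa>: "\<forall>p. \<bar>\<kappa> p\<bar> \<le> 1"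
      and y: "solves_on (\<lambda>p. \<kappa> p * F p) S y" and x: "x \<in> S"
    have "\<bar>V (y x) - V (y a)\<bar> \<le> C * \<bar>x - a\<bar>"
    proof (rule DERIV_bound_imp_lipschitz[OF S(1)])
      fix t assume t: "t \<in> S"
      then have "(y has_real_derivative \<kappa> (t, y t) * F (t, y t)) (at t within S)"
        using y by (auto simp: solves_on_def)
      from DERIV_chain2[OF V(1) this]
      show "((\<lambda>t. V (y t)) has_real_derivative V' (y t) * (\<kappa> (t, y t) * F (t, y t))) (at t within S)" .
      have "\<bar>V' (y t) * (\<kappa> (t, y t) * F (t, y t))\<bar> = \<bar>\<kappa> (t, y t)\<bar> * \<bar>V' (y t) * F (t, y t)\<bar>"
        by (simp add: abs_mult)
      also have "\<dots> \<le> 1 * \<bar>V' (y t) * F (t, y t)\<bar>"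
        using \<kappa> by (intro mult_right_mono) auto
      also have "\<dots> \<le> C"
        using c(2)[of "y t" t] C(2)[of t] t S by auto
      finally show "\<bar>V' (y t) * (\<kappa> (t, y t) * F (t, y t))\<bar> \<le> C" .
    qed (use x S in auto)
    also have "\<dots> \<le> C * (b - a)"
      using C x S by (intro mult_left_mono) auto
    finally show "\<bar>y x\<bar> \<le> R"
      using a by (intro R) auto
  qed
qed

text \<open>
  Cut \<open>F\<close> off outside the a priori radius \<open>R\<close>. The resulting bounded right-hand side has a solution,
  which satisfies the a priori bound and therefore never meets the cutoff.
\<close>

lemma Lyapunov_solution_on_compact_interval:
  assumes F: "continuous_on UNIV F" and L: "has_Lyapunov_function F" and ab: "a \<le> b"
  obtains y where "y a = v" "solves_on F {a..b} y"
proof -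
  obtain R where R: "\<And>\<kappa> S y x. \<lbrakk>convex S; a \<in> S; S \<subseteq> {a..b}; y a = v; \<forall>p. \<bar>\<kappa> p\<bar> \<le> (1::real);
      solves_on (\<lambda>p. \<kappa> p * F p) S y; x \<in> S\<rbrakk> \<Longrightarrow> \<bar>y x\<bar> \<le> R"
    using Lyapunov_bound[OF L, of a b v] by blast
  define \<kappa> where "\<kappa> = (\<lambda>p::real \<times> real. max 0 (min 1 (R + 1 - \<bar>snd p\<bar>)))"
  define G where "G = (\<lambda>p. \<kappa> p * F (max a (min b (fst p)), snd p))"
  have G: "continuous_on UNIV G"
    unfolding G_def \<kappa>_def by (intro continuous_intros continuous_on_compose2[OF F]) auto
  obtain M where M: "0 \<le> M" "\<And>x y. x \<in> {a..b} \<Longrightarrow> \<bar>y\<bar> \<le> R + 1 \<Longrightarrow> \<bar>F (x, y)\<bar> \<le> M"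
    using continuous_imp_bounded_on_rectangle[OF F] by metis
  have \<kappa>1: "\<bar>\<kappa> p\<bar> \<le> 1" for p
    by (auto simp: \<kappa>_def)
  have GM: "\<bar>G p\<bar> \<le> M" for p
  proof (cases "\<bar>snd p\<bar> \<le> R + 1")
    case True
    then have "\<bar>F (max a (min b (fst p)), snd p)\<bar> \<le> M"
      using ab by (intro M) auto
    then have "\<bar>\<kappa> p\<bar> * \<bar>F (max a (min b (fst p)), snd p)\<bar> \<le> 1 * M"
      by (intro mult_mono \<kappa>1) auto
    then show ?thesis
      by (simp add: G_def abs_mult)
  next
    case False
    then show ?thesis
      using M(1) by (simp add: G_def \<kappa>_def)
  qed
  obtain y where y: "y a = v" "solves_on G {a..b} y"
    using bounded_Peano[OF G GM] by blast
  have y': "solves_on (\<lambda>p. \<kappa> p * F p) {a..b} y"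
    using y(2) by (simp add: solves_on_def G_def max_absorb2 min_absorb2)
  have "\<kappa> (x, y x) = 1" if "x \<in> {a..b}" for x
    using R[of "{a..b}" y \<kappa> x] y(1) y' \<kappa>1 that ab by (simp add: \<kappa>_def)
  then have "solves_on F {a..b} y"
    using y' by (simp add: solves_on_def)
  with y(1) show thesis
    by (rule that)
qed

text \<open>
  Uniqueness is not available, so the solutions on \<open>[a, a + n]\<close> have to be chosen one after another,
  each extending the previous one.
\<close>

lemma Lyapunov_solution_forward:
  assumes F: "continuous_on UNIV F" and L: "has_Lyapunov_function F"
  obtains y where "y a = v" "solves_on F {a..} y"
proof -
  have "\<exists>f. \<forall>n. (f n a = v \<and> solves_on F {a..a + real n} (f n)) \<and> (\<forall>x\<le>a + real n. f (Suc n) x = f n x)"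
  proof (rule dependent_nat_choice)
    show "\<exists>y. y a = v \<and> solves_on F {a..a + real 0} y"
      using Lyapunov_solution_on_compact_interval[OF F L, of a a v] by auto
  next
    fix y n assume y: "y a = v \<and> solves_on F {a..a + real n} y"
    obtain z where z: "z (a + real n) = y (a + real n)"
      "solves_on F {a + real n..a + real (Suc n)} z"
      using Lyapunov_solution_on_compact_interval[OF F L, of "a + real n" "a + real (Suc n)"] by auto
    have "solves_on F ({a..a + real n} \<union> {a + real n..a + real (Suc n)})
            (\<lambda>x. if x \<le> a + real n then y x else z x)"
      by (rule solves_on_glue) (use y z in auto)
    moreover have "{a..a + real n} \<union> {a + real n..a + real (Suc n)} = {a..a + real (Suc n)}"
      by auto
    ultimately show "\<exists>z. (z a = v \<and> solves_on F {a..a + real (Suc n)} z) \<and> (\<forall>x\<le>a + real n. z x = y x)"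
      using y by (intro exI[of _ "\<lambda>x. if x \<le> a + real n then y x else z x"]) simp
  qed
  then obtain f where f: "\<And>n. f n a = v" "\<And>n. solves_on F {a..a + real n} (f n)"
    and step: "\<And>n x. x \<le> a + real n \<Longrightarrow> f (Suc n) x = f n x"
    by blast
  have stable: "f m x = f n x" if "n \<le> m" "x \<le> a + real n" for m n x
    using that by (induction m rule: dec_induct) (auto simp: step)
  define Y where "Y = (\<lambda>x. f (nat \<lceil>x - a\<rceil>) x)"
  have Y: "Y x = f n x" if "x \<le> a + real n" for n x
    unfolding Y_def using that of_nat_ceiling[of "x - a"]
    by (intro stable[symmetric]) (auto simp: nat_le_iff ceiling_le_iff)
  have "solves_on F {a..} Y"
    unfolding solves_on_def
  proof
    fix x assume x: "x \<in> {a..}"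
    obtain n :: nat where n: "x - a < n"
      using reals_Archimedean2 by blast
    have "solves_on F {a..a + real n} Y"
      by (rule solves_on_cong[OF f(2)]) (simp add: Y)
    then have "(Y has_real_derivative F (x, Y x)) (at x within {a..a + real n})"
      using x n by (simp add: solves_on_def)
    moreover have "at x within {a..a + real n} = at x within {a..}"
      by (rule at_within_nhd[of _ "{..<a + real n}"]) (use n in auto)
    ultimately show "(Y has_real_derivative F (x, Y x)) (at x within {a..})"
      by simp
  qed
  moreover have "Y a = v"
    by (simp add: Y_def f)
  ultimately show thesis
    using that by blast
qed

text \<open>
  A bounded solution is Lipschitz, so it has a limit at the endpoint. The integral equation then
  yields the one-sided derivative there.
\<close>

lemma bounded_solution_extends_to_endpoint:
  assumes F: "continuous_on UNIV F" and ab: "a < b"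
    and y: "solves_on F {a..<b} y" and R: "\<And>x. x \<in> {a..<b} \<Longrightarrow> \<bar>y x\<bar> \<le> R"
  obtains z where "solves_on F {a..b} z" "\<And>x. x \<in> {a..<b} \<Longrightarrow> z x = y x"
proof -
  obtain M where M: "0 \<le> M" "\<And>x y. x \<in> {a..b} \<Longrightarrow> \<bar>y\<bar> \<le> R \<Longrightarrow> \<bar>F (x, y)\<bar> \<le> M"
    using continuous_imp_bounded_on_rectangle[OF F] by metis
  have "\<bar>y s - y t\<bar> \<le> M * \<bar>s - t\<bar>" if "s \<in> {a..<b}" "t \<in> {a..<b}" for s t
    using y M(2) R that unfolding solves_on_def
    by (intro DERIV_bound_imp_lipschitz[of "{a..<b}" y "\<lambda>x. F (x, y x)"]) auto
  then have "M-lipschitz_on {a..<b} y"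
    using M(1) by (intro lipschitz_onI) (auto simp: dist_real_def)
  then obtain g where g: "uniformly_continuous_on (closure {a..<b}) g"
    and gy: "\<And>x. x \<in> {a..<b} \<Longrightarrow> y x = g x"
    using lipschitz_on_uniformly_continuous uniformly_continuous_on_extension_on_closure by metis
  have gcont: "continuous_on {a..b} g"
    using uniformly_continuous_imp_continuous[OF g] ab by simp
  have gF: "continuous_on {a..b} (\<lambda>x. F (x, g x))"
    by (rule continuous_on_compose_curve[OF F gcont])
  have gder: "(g has_real_derivative F (x, g x)) (at x)" if "x \<in> {a<..<b}" for x
  proof -
    have "solves_on F {a<..<b} g"
      by (rule solves_on_cong[OF solves_on_subset[OF y]]) (auto simp: gy)
    then show ?thesis
      using that by (simp add: solves_on_open_iff)
  qed
  have geq: "g x = g a + integral {a..x} (\<lambda>t. F (t, g t))" if x: "x \<in> {a..b}" for x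
  proof -
    have "((\<lambda>t. F (t, g t)) has_integral (g x - g a)) {a..x}"
      by (rule fundamental_theorem_of_calculus_interior)
         (use x gder continuous_on_subset[OF gcont] in
            \<open>auto simp: has_real_derivative_iff_has_vector_derivative[symmetric]\<close>)
    then show ?thesis
      by (simp add: integral_unique)
  qed
  have "solves_on F {a..b} (\<lambda>x. g a + integral {a..x} (\<lambda>t. F (t, g t)))"
    unfolding solves_on_def
  proof
    fix x assume x: "x \<in> {a..b}"
    show "((\<lambda>x. g a + integral {a..x} (\<lambda>t. F (t, g t))) has_real_derivative
            F (x, g a + integral {a..x} (\<lambda>t. F (t, g t)))) (at x within {a..b})"
      using integral_has_real_derivative[OF gF x] geq[OF x]
      by (auto intro!: derivative_eq_intros)
  qed
  then have "solves_on F {a..b} g"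
    by (rule solves_on_cong) (rule geq)
  then show thesis
    using that gy by metis
qed

text \<open>
  If \<open>I\<close> is bounded above, complete the solution at \<open>b = Sup I\<close> and append a forward solution
  that starts from the value reached there.
\<close>

lemma Lyapunov_extension_forward:
  assumes F: "continuous_on UNIV F" and L: "has_Lyapunov_function F"
    and I: "open_interval_around_0 I" and y: "solves_on F I y"
  obtains Y where "solves_on F (I \<union> {0..}) Y" "\<And>x. x \<in> I \<Longrightarrow> Y x = y x"
proof (cases "{0..} \<subseteq> I")
  case True
  then have "I \<union> {0..} = I"
    by auto
  with y show thesis
    using that[of y] by simp
next
  case False
  then obtain p where p: "0 \<le> p" "p \<notin> I"
    by auto
  have o: "open I" and i: "is_interval I" and 0: "0 \<in> I"
    using I by (auto simp: open_interval_around_0_def)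
  define b where "b = Sup I"
  have "x \<le> p" if "x \<in> I" for x
    using mem_is_interval_1_I[OF i 0 that, of p] p by (cases "x \<le> p") auto
  then have bdd: "bdd_above I"
    by (auto simp: bdd_above_def)
  have "b \<notin> I"
  proof
    assume "b \<in> I"
    then obtain e where "e > 0" "cball b e \<subseteq> I"
      using o open_contains_cball by blast
    then have "b + e \<in> I"
      by (auto simp: cball_def dist_real_def subset_iff)
    then have "b + e \<le> b"
      unfolding b_def by (rule cSup_upper[OF _ bdd])
    with \<open>e > 0\<close> show False
      by simp
  qed
  have I_less: "x < b" if "x \<in> I" for x
    using cSup_upper[OF that bdd] that \<open>b \<notin> I\<close> unfolding b_def[symmetric]
    by (metis order_le_less)
  have b: "0 < b"
    using I_less 0 .
  have in_I: "x \<in> I" if x: "0 \<le> x" "x < b" for x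
  proof -
    obtain t where "t \<in> I" "x < t"
      using x(2) 0 unfolding b_def by (metis empty_iff less_cSupE)
    then show ?thesis
      using mem_is_interval_1_I[OF i 0, of t x] x by simp
  qed
  have in_I_iff: "x \<in> I \<longleftrightarrow> x < b" if "0 \<le> x" for x
    using in_I[OF that] I_less by blast
  have y0: "solves_on F {0..<b} y"
    by (rule solves_on_subset[OF y]) (use in_I in auto)
  obtain R where "\<And>\<kappa> S u x. \<lbrakk>convex S; 0 \<in> S; S \<subseteq> {0..b}; u 0 = y 0; \<forall>p. \<bar>\<kappa> p\<bar> \<le> (1::real);
      solves_on (\<lambda>p. \<kappa> p * F p) S u; x \<in> S\<rbrakk> \<Longrightarrow> \<bar>u x\<bar> \<le> R"
    using Lyapunov_bound[OF L, of 0 b "y 0"] by blast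
  from this[of "{0..<b}" y "\<lambda>_. 1"] have "\<bar>y x\<bar> \<le> R" if "x \<in> {0..<b}" for x
    using y0 b that by (auto simp: subset_iff)
  then obtain z where z: "solves_on F {0..b} z" "\<And>x. x \<in> {0..<b} \<Longrightarrow> z x = y x"
    using bounded_solution_extends_to_endpoint[OF F b y0] by metis
  \<comment> \<open>The extension \<open>z\<close> is defined on \<open>{0..b}\<close> only, so it has to be glued to the part of \<open>y\<close>
    left of \<open>0\<close>.\<close>
  define w where "w = (\<lambda>x. if x \<le> 0 then y x else z x)"
  have "solves_on F (I \<inter> {..0} \<union> {0..b}) w"
    unfolding w_def
  proof (rule solves_on_glue)
    show "solves_on F (I \<inter> {..0}) y"
      by (rule solves_on_subset[OF y]) simp
    show "y 0 = z 0"
      using z(2)[of 0] b by simp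
  qed (use z(1) 0 b in simp_all)
  moreover have "I \<inter> {..0} \<union> {0..b} = I \<union> {b}"
  proof (intro set_eqI)
    fix x
    show "x \<in> I \<inter> {..0} \<union> {0..b} \<longleftrightarrow> x \<in> I \<union> {b}"
      using in_I_iff[of x] b by (cases "0 \<le> x") auto
  qed
  ultimately have w: "solves_on F (I \<union> {b}) w"
    by simp
  have wy: "w x = y x" if "x \<in> I" for x
    using z(2)[of x] I_less[OF that] by (simp add: w_def)
  obtain u where u: "u b = w b" "solves_on F {b..} u"
    using Lyapunov_solution_forward[OF F L] by metis
  have "solves_on F (I \<union> {b} \<union> {b..}) (\<lambda>x. if x \<le> b then w x else u x)"
    by (rule solves_on_glue[OF w u(2)]) (use I_less u in \<open>auto intro: less_imp_le\<close>)
  moreover have "I \<union> {b} \<union> {b..} = I \<union> {0..}"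
  proof (intro set_eqI)
    fix x
    show "x \<in> I \<union> {b} \<union> {b..} \<longleftrightarrow> x \<in> I \<union> {0..}"
      using in_I_iff[of x] b by (cases "0 \<le> x") auto
  qed
  ultimately have "solves_on F (I \<union> {0..}) (\<lambda>x. if x \<le> b then w x else u x)"
    by simp
  then show thesis
  proof (rule that)
    show "(if x \<le> b then w x else u x) = y x" if "x \<in> I" for x
      using wy[OF that] I_less[OF that] by simp
  qed
qed

theorem Lyapunov_continuation:
  assumes F: "continuous_on UNIV F" and L: "has_Lyapunov_function F"
    and y: "local_solution F y0 I y"
  obtains Y where "global_solution F y0 Y" "\<And>x. x \<in> I \<Longrightarrow> Y x = y x"
proof -
  have I: "open_interval_around_0 I" and y0: "y 0 = y0" and yI: "solves_on F I y"
    using y by (auto simp: local_solution_def solves_ivp_on_def open_interval_around_0_def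
        solves_on_open_iff)
  obtain z where z: "solves_on F (I \<union> {0..}) z" "\<And>x. x \<in> I \<Longrightarrow> z x = y x"
    using Lyapunov_extension_forward[OF F L I yI] by blast
  define J where "J = uminus ` (I \<union> {0..})"
  have "I \<union> {0..} = I \<union> {0<..}"
    using I by (auto simp: open_interval_around_0_def order_le_less)
  then have "open J"
    using I unfolding J_def open_interval_around_0_def by (intro open_negations) auto
  moreover have "is_interval (I \<union> {0..})"
    using I unfolding open_interval_around_0_def is_interval_1 by (metis Un_iff atLeast_iff le_cases order_trans)
  ultimately have J: "open_interval_around_0 J"
    using I by (auto simp: open_interval_around_0_def J_def)
  have "solves_on (time_reversal F) J (\<lambda>x. z (- x))"
    unfolding J_def by (rule solves_on_time_reversal[OF z(1)])
  then obtain u where u: "solves_on (time_reversal F) (J \<union> {0..}) u"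
    "\<And>x. x \<in> J \<Longrightarrow> u x = z (- x)"
    using Lyapunov_extension_forward[OF continuous_on_time_reversal[OF F]
        has_Lyapunov_function_time_reversal[OF L] J] by metis
  have "uminus ` (J \<union> {0..}) = UNIV"
  proof (intro set_eqI iffI UNIV_I)
    fix x :: real
    show "x \<in> uminus ` (J \<union> {0..})"
      by (rule image_eqI[of _ _ "- x"]) (auto simp: J_def)
  qed
  then have "solves_on F UNIV (\<lambda>x. u (- x))"
    using solves_on_time_reversal[OF u(1)] by simp
  moreover have uy: "u (- x) = y x" if "x \<in> I" for x
    using u(2)[of "- x"] z(2)[OF that] that by (simp add: J_def)
  moreover have "u (- 0) = y0"
    using uy[of 0] y0 I by (simp add: open_interval_around_0_def)
  ultimately show thesis
    using that[of "\<lambda>x. u (- x)"] by (simp add: global_solution_def solves_ivp_on_def solves_on_def)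
qed

section \<open>Continuous comparison functions and their antiderivatives\<close>

lemma antiderivative_exists:
  fixes f :: "real \<Rightarrow> real"
  assumes "continuous_on UNIV f"
  obtains \<Phi> where "\<And>s. (\<Phi> has_real_derivative f s) (at s)"
proof -
  have "\<exists>\<Phi>. \<forall>s::real. - \<infinity> < ereal s \<longrightarrow> ereal s < \<infinity> \<longrightarrow> (\<Phi> has_vector_derivative f s) (at s)"
    by (rule einterval_antiderivative) (use assms in \<open>auto simp: continuous_on_eq_continuous_at\<close>)
  then show thesis
    using that by (auto simp: has_real_derivative_iff_has_vector_derivative)
qed

text \<open>
  The integral test for an arbitrary antiderivative \<open>\<Phi>\<close> of \<open>f\<close>: by the mean value theorem, its increment
  over a unit interval lies between the values of \<open>f\<close> at the two ends.
\<close>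

context
  fixes f \<Phi> :: "real \<Rightarrow> real"
  assumes deriv: "\<And>s. (\<Phi> has_real_derivative f s) (at s)"
    and pos: "\<And>s. 0 < f s" and anti: "antimono f"
begin

lemma antiderivative_mono: "s \<le> t \<Longrightarrow> \<Phi> s \<le> \<Phi> t"
  using DERIV_nonneg_imp_nondecreasing[of s t \<Phi>] deriv pos by (meson less_imp_le)

lemma antiderivative_increment:
  "f (real (Suc n)) \<le> \<Phi> (real (Suc n)) - \<Phi> (real n)"
  "\<Phi> (real (Suc n)) - \<Phi> (real n) \<le> f (real n)"
proof -
  obtain z where "real n < z" "z < real (Suc n)"
    "\<Phi> (real (Suc n)) - \<Phi> (real n) = (real (Suc n) - real n) * f z"
    using MVT2[of "real n" "real (Suc n)" \<Phi> f] deriv by auto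
  then show "f (real (Suc n)) \<le> \<Phi> (real (Suc n)) - \<Phi> (real n)"
    "\<Phi> (real (Suc n)) - \<Phi> (real n) \<le> f (real n)"
    using antimonoD[OF anti, of "real n" z] antimonoD[OF anti, of z "real (Suc n)"] by auto
qed

lemma antiderivative_bounded_if_summable:
  assumes "summable (\<lambda>n. f (real n))"
  obtains B where "\<And>s. \<Phi> s \<le> B"
proof -
  have "\<Phi> s \<le> \<Phi> 0 + (\<Sum>n. f (real n))" for s
  proof -
    obtain n :: nat where "s \<le> n"
      using real_arch_simple by blast
    then have "\<Phi> s \<le> \<Phi> (real n)"
      by (rule antiderivative_mono)
    also have "\<dots> = \<Phi> 0 + (\<Sum>k<n. \<Phi> (real (Suc k)) - \<Phi> (real k))"
      using sum_lessThan_telescope[of "\<lambda>k. \<Phi> (real k)" n] by simp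
    also have "(\<Sum>k<n. \<Phi> (real (Suc k)) - \<Phi> (real k)) \<le> (\<Sum>k<n. f (real k))"
      by (intro sum_mono antiderivative_increment)
    also have "\<dots> \<le> (\<Sum>n. f (real n))"
      using assms pos by (intro sum_le_suminf) (auto intro: less_imp_le)
    finally show ?thesis
      by simp
  qed
  then show thesis
    by (rule that)
qed

lemma antiderivative_unbounded_if_not_summable:
  assumes "\<not> summable (\<lambda>n. f (real n))"
  obtains S where "\<And>s. s \<ge> S \<Longrightarrow> B < \<Phi> s"
proof -
  have "\<exists>n. B < \<Phi> (real n)"
  proof (rule ccontr)
    assume *: "\<nexists>n. B < \<Phi> (real n)"
    have "summable (\<lambda>n. f (real (Suc n)))"
    proof (rule summableI_nonneg_bounded)
      fix n
      show "0 \<le> f (real (Suc n))"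
        using pos by (rule less_imp_le)
      have "(\<Sum>k<n. f (real (Suc k))) \<le> (\<Sum>k<n. \<Phi> (real (Suc k)) - \<Phi> (real k))"
        by (intro sum_mono antiderivative_increment)
      also have "\<dots> = \<Phi> (real n) - \<Phi> 0"
        using sum_lessThan_telescope[of "\<lambda>k. \<Phi> (real k)" n] by simp
      finally show "(\<Sum>k<n. f (real (Suc k))) \<le> B - \<Phi> 0"
        using * by (meson diff_right_mono not_le order_trans)
    qed
    then show False
      using assms summable_Suc_iff[of "\<lambda>n. f (real n)"] by simp
  qed
  then show thesis
    using that antiderivative_mono by (meson less_le_trans)
qed

end

text \<open>
  Averaging over a window of length one makes a monotone function continuous at the price of a
  shift by one, and such a shift changes neither the convergence nor the divergence of
  \<open>\<Sum>1/p(n)\<close>.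
\<close>

lemma continuous_average_of_mono:
  fixes p :: "real \<Rightarrow> real"
  assumes p: "mono p"
  obtains \<beta> where "continuous_on UNIV \<beta>" "mono \<beta>"
    and "\<And>s. p s \<le> \<beta> s" "\<And>s. \<beta> s \<le> p (s + 1)"
proof -
  have int: "q integrable_on {a..b}" if "mono q" for q :: "real \<Rightarrow> real" and a b
    using that by (intro integrable_on_lebesgue_on integrable_mono_on) (auto simp: mono_on_def mono_def)
  define \<beta> where "\<beta> = (\<lambda>s. integral {s..s + 1} p)"
  have lower: "p s \<le> \<beta> s" for s
  proof -
    have "integral {s..s + 1} (\<lambda>_. p s) \<le> \<beta> s"
      unfolding \<beta>_def by (intro integral_le int[OF p] integrable_const_ivl) (auto intro: monoD[OF p])
    then show ?thesis
      by simp
  qed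
  have upper: "\<beta> s \<le> p (s + 1)" for s
  proof -
    have "\<beta> s \<le> integral {s..s + 1} (\<lambda>_. p (s + 1))"
      unfolding \<beta>_def by (intro integral_le int[OF p] integrable_const_ivl) (auto intro: monoD[OF p])
    then show ?thesis
      by simp
  qed
  have "mono \<beta>"
  proof (rule monoI)
    fix s t :: real assume "s \<le> t"
    have shift: "\<beta> t = integral {s..s + 1} (\<lambda>x. p (x + (t - s)))"
      using integral_shift_real_ivl[of t "t - s" "t + 1" p] unfolding \<beta>_def by (simp add: algebra_simps)
    have "(\<lambda>x. p (x + (t - s))) integrable_on {s..s + 1}"
      by (intro int monoI monoD[OF p]) simp
    then show "\<beta> s \<le> \<beta> t"
      unfolding shift unfolding \<beta>_def using \<open>s \<le> t\<close>
      by (intro integral_le int[OF p]) (auto intro: monoD[OF p])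
  qed
  moreover have "continuous_on UNIV \<beta>"
    unfolding continuous_on_eq_continuous_at[OF open_UNIV]
  proof
    fix s :: real
    let ?P = "\<lambda>x. integral {s - 1..x} p"
    have P: "continuous_on {s - 1..s + 2} ?P"
      by (rule indefinite_integral_continuous_1[OF int[OF p]])
    have "continuous_on {s - 1<..<s + 1} (\<lambda>x. ?P (x + 1) - ?P x)"
      by (intro continuous_intros continuous_on_compose2[OF P]) auto
    moreover have "\<beta> x = ?P (x + 1) - ?P x" if "x \<in> {s - 1<..<s + 1}" for x
    proof -
      have "?P x + integral {x..x + 1} p = ?P (x + 1)"
        using that int[OF p] by (intro Henstock_Kurzweil_Integration.integral_combine) auto
      then show ?thesis
        by (simp add: \<beta>_def)
    qed
    ultimately have "continuous_on {s - 1<..<s + 1} \<beta>"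
      by (rule continuous_on_eq[OF _ sym])
    then show "isCont \<beta> s"
      by (simp add: continuous_on_eq_continuous_at)
  qed
  ultimately show thesis
    using that lower upper by blast
qed

text \<open>
  In the divergent case \<open>\<Phi>\<close> is a scale that tends to infinity, while the growth rate \<open>\<beta> \<ge> \<phi>\<close>
  advances it with speed one: \<open>s' = \<beta> s\<close> means \<open>(\<Phi> s)' = 1\<close>.
\<close>

lemma continuous_majorant:
  fixes \<phi> :: "real \<Rightarrow> real"
  assumes pos: "\<And>t. t \<ge> 0 \<Longrightarrow> \<phi> t > 0" and mono: "mono_on {0..} \<phi>"
    and div: "\<not> summable (\<lambda>n. 1 / \<phi> (real (Suc n)))"
  obtains \<beta> \<Phi> where "mono \<beta>" "\<And>s. 0 < \<beta> s" "\<And>s. 0 \<le> s \<Longrightarrow> \<phi> s \<le> \<beta> s"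
    and "\<And>s. (\<Phi> has_real_derivative 1 / \<beta> s) (at s)" "\<And>B. \<exists>S. \<forall>s\<ge>S. B < \<Phi> s"
proof -
  have "mono (\<lambda>t. \<phi> (max 0 t))"
    by (rule monoI) (auto intro!: mono_onD[OF mono])
  then obtain \<beta> where \<beta>: "continuous_on UNIV \<beta>" "mono \<beta>"
    and lower: "\<And>s. \<phi> (max 0 s) \<le> \<beta> s" and upper: "\<And>s. \<beta> s \<le> \<phi> (max 0 (s + 1))"
    using continuous_average_of_mono by metis
  have \<beta>pos: "0 < \<beta> s" for s
    using lower[of s] pos[of "max 0 s"] by simp
  have "continuous_on UNIV (\<lambda>s. 1 / \<beta> s)"
    using \<beta>pos by (intro continuous_intros \<beta>) (metis less_irrefl)
  then obtain \<Phi> where \<Phi>: "\<And>s. (\<Phi> has_real_derivative 1 / \<beta> s) (at s)"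
    using antiderivative_exists by blast
  have \<beta>inv: "0 < 1 / \<beta> s" for s
    using \<beta>pos by simp
  have anti: "antimono (\<lambda>s. 1 / \<beta> s)"
    using \<beta>(2) \<beta>pos by (auto intro!: antimonoI divide_left_mono dest: monoD)
  have "\<not> summable (\<lambda>n. 1 / \<beta> (real n))"
  proof
    assume "summable (\<lambda>n. 1 / \<beta> (real n))"
    then have "summable (\<lambda>n. 1 / \<phi> (real (Suc n)))"
    proof (rule summable_comparison_test'[where N = 0])
      fix n :: nat
      show "norm (1 / \<phi> (real (Suc n))) \<le> 1 / \<beta> (real n)"
        using upper[of "real n"] \<beta>pos[of "real n"] pos[of "real (Suc n)"]
        by (simp add: frac_le add.commute)
    qed
    with div show False ..
  qed
  note unbounded = antiderivative_unbounded_if_not_summable[OF \<Phi> \<beta>inv anti this]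
  have "\<exists>S. \<forall>s\<ge>S. B < \<Phi> s" for B
    by (rule unbounded[of B]) blast
  moreover have "\<phi> s \<le> \<beta> s" if "0 \<le> s" for s
    using lower[of s] that by simp
  ultimately show thesis
    using that[OF \<beta>(2) \<beta>pos _ \<Phi>] by blast
qed

text \<open>
  In the convergent case the corresponding scale \<open>Q\<close> is bounded, so that growth at the rate
  \<open>\<alpha> \<le> \<phi>\<close> exhausts it in finite time.
\<close>

lemma continuous_minorant:
  fixes \<phi> :: "real \<Rightarrow> real"
  assumes pos: "\<And>t. t \<ge> 0 \<Longrightarrow> \<phi> t > 0" and mono: "mono_on {0..} \<phi>"
    and conv: "summable (\<lambda>n. 1 / \<phi> (real (Suc n)))"
  obtains \<alpha> Q B where "continuous_on UNIV \<alpha>" "mono \<alpha>" "\<And>s. 0 < \<alpha> s"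
    and "\<And>s. 0 \<le> s \<Longrightarrow> \<alpha> s \<le> \<phi> s"
    and "\<And>s. (Q has_real_derivative 1 / \<alpha> s) (at s)" "\<And>s. Q s \<le> B"
proof -
  have "mono (\<lambda>t. \<phi> (max 0 t))"
    by (rule monoI) (auto intro!: mono_onD[OF mono])
  then obtain \<beta> where \<beta>: "continuous_on UNIV \<beta>" "mono \<beta>"
    and lower: "\<And>s. \<phi> (max 0 s) \<le> \<beta> s" and upper: "\<And>s. \<beta> s \<le> \<phi> (max 0 (s + 1))"
    using continuous_average_of_mono by metis
  \<comment> \<open>The average over \<open>[s - 1, s]\<close> lies below the value at \<open>s\<close>.\<close>
  define \<alpha> where "\<alpha> = (\<lambda>s. \<beta> (s - 1))"
  have \<alpha>pos: "0 < \<alpha> s" for s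
    using lower[of "s - 1"] pos[of "max 0 (s - 1)"] by (simp add: \<alpha>_def)
  have \<alpha>cont: "continuous_on UNIV \<alpha>"
    unfolding \<alpha>_def by (intro continuous_on_compose2[OF \<beta>(1)] continuous_intros) auto
  have \<alpha>mono: "mono \<alpha>"
    unfolding \<alpha>_def by (intro monoI monoD[OF \<beta>(2)]) simp
  have "continuous_on UNIV (\<lambda>s. 1 / \<alpha> s)"
    using \<alpha>pos by (intro continuous_intros \<alpha>cont) (metis less_irrefl)
  then obtain Q where Q: "\<And>s. (Q has_real_derivative 1 / \<alpha> s) (at s)"
    using antiderivative_exists by blast
  have \<alpha>inv: "0 < 1 / \<alpha> s" for s
    using \<alpha>pos by simp
  have anti: "antimono (\<lambda>s. 1 / \<alpha> s)"
    using \<alpha>mono \<alpha>pos by (auto intro!: antimonoI divide_left_mono dest: monoD)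
  have "summable (\<lambda>n. 1 / \<alpha> (real (n + 2)))"
    using conv
  proof (rule summable_comparison_test'[where N = 0])
    fix n :: nat
    show "norm (1 / \<alpha> (real (n + 2))) \<le> 1 / \<phi> (real (Suc n))"
      using lower[of "real (Suc n)"] \<alpha>pos[of "real (n + 2)"] pos[of "real (Suc n)"]
      by (simp add: frac_le add.commute \<alpha>_def)
  qed
  then have "summable (\<lambda>n. 1 / \<alpha> (real n))"
    by (subst (asm) summable_iff_shift)
  from antiderivative_bounded_if_summable[OF Q \<alpha>inv anti this]
  obtain B where "\<And>s. Q s \<le> B"
    by blast
  moreover have "\<alpha> s \<le> \<phi> s" if "0 \<le> s" for s
    using upper[of "s - 1"] that by (simp add: \<alpha>_def)
  ultimately show thesis
    using that[OF \<alpha>cont \<alpha>mono \<alpha>pos _ Q] by blast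
qed

section \<open>Divergent series: uniqueness and continuation\<close>

text \<open>
  In the variable \<open>s = - ln \<bar>u\<bar>\<close> the hypothesis on \<open>u'\<close> reads \<open>\<bar>s'\<bar> \<le> C * \<beta> s\<close>, so \<open>\<Phi> s\<close> is Lipschitz
  wherever \<open>u\<close> does not vanish. Immediately after the last zero of \<open>u\<close>, however, \<open>s\<close> and with it
  \<open>\<Phi> s\<close> would be unbounded.
\<close>

lemma Osgood_vanishing:
  fixes u u' \<beta> \<Phi> :: "real \<Rightarrow> real"
  assumes \<beta>: "\<And>s. 0 < \<beta> s" and \<Phi>: "\<And>s. (\<Phi> has_real_derivative 1 / \<beta> s) (at s)"
    and unbounded: "\<And>B. \<exists>S. \<forall>s\<ge>S. B < \<Phi> s"
    and d: "0 \<le> d" and u0: "u 0 = 0"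
    and u: "\<And>x. x \<in> {0..d} \<Longrightarrow> (u has_real_derivative u' x) (at x within {0..d})"
    and u': "\<And>x. \<lbrakk>x \<in> {0..d}; u x \<noteq> 0\<rbrakk> \<Longrightarrow> \<bar>u' x\<bar> \<le> C * (\<bar>u x\<bar> * \<beta> (- ln \<bar>u x\<bar>))"
  shows "u d = 0"
proof (rule ccontr)
  assume ud: "u d \<noteq> 0"
  define Z where "Z = {x \<in> {0..d}. u x = 0}"
  have cont: "continuous_on {0..d} u"
    using u by (rule DERIV_continuous_on)
  have Z: "closed Z" "Z \<noteq> {}" "bdd_above Z"
    using continuous_closed_preimage_constant[OF cont closed_atLeastAtMost, of 0] u0 d
    by (auto simp: Z_def intro: bdd_aboveI[of _ d])
  define c where "c = Sup Z"
  have "c \<in> Z"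
    unfolding c_def using Z by (intro closed_contains_Sup)
  then have c: "0 \<le> c" "c < d" "u c = 0"
    using ud by (auto simp: Z_def order_le_less)
  have nz: "u x \<noteq> 0" if "x \<in> {c<..d}" for x
  proof
    assume "u x = 0"
    then have "x \<in> Z"
      using that c by (simp add: Z_def)
    then have "x \<le> c"
      unfolding c_def using Z(3) by (rule cSup_upper)
    then show False
      using that by simp
  qed
  have lip: "\<bar>\<Phi> (- ln \<bar>u s\<bar>) - \<Phi> (- ln \<bar>u t\<bar>)\<bar> \<le> C * \<bar>s - t\<bar>" if "s \<in> {c<..d}" "t \<in> {c<..d}" for s t
  proof (rule DERIV_bound_imp_lipschitz[OF _ _ _ that])
    fix x assume x: "x \<in> {c<..d}"
    have abs_ln: "- ln \<bar>r\<bar> = - (ln (r\<^sup>2) / 2)" for r :: real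
      using ln_realpow[of "\<bar>r\<bar>" 2] by (cases "r = 0") simp_all
    have "(u has_real_derivative u' x) (at x within {c<..d})"
      by (rule DERIV_subset[OF u]) (use x c in auto)
    then have "((\<lambda>x. - ln \<bar>u x\<bar>) has_real_derivative - (u' x / u x)) (at x within {c<..d})"
      unfolding abs_ln using nz[OF x]
      by (auto intro!: derivative_eq_intros simp: field_simps power2_eq_square zero_less_mult_iff linorder_neq_iff)
    from DERIV_chain2[OF \<Phi> this]
    show "((\<lambda>x. \<Phi> (- ln \<bar>u x\<bar>)) has_real_derivative
             1 / \<beta> (- ln \<bar>u x\<bar>) * - (u' x / u x)) (at x within {c<..d})" .
    have "\<bar>u' x\<bar> / (\<bar>u x\<bar> * \<beta> (- ln \<bar>u x\<bar>)) \<le> C"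
      using u'[of x] x c nz[OF x] \<beta> by (subst pos_divide_le_eq) auto
    then show "\<bar>1 / \<beta> (- ln \<bar>u x\<bar>) * - (u' x / u x)\<bar> \<le> C"
      using \<beta>[of "- ln \<bar>u x\<bar>"] by (simp add: abs_mult abs_divide mult.commute)
  qed simp
  have W: "\<Phi> (- ln \<bar>u x\<bar>) \<le> \<Phi> (- ln \<bar>u d\<bar>) + C * \<bar>x - d\<bar>" if "x \<in> {c<..d}" for x
    using lip[OF that, of d] c by (simp add: abs_le_iff)
  define B where "B = \<Phi> (- ln \<bar>u d\<bar>) + \<bar>C\<bar> * (d - c)"
  have W': "\<Phi> (- ln \<bar>u x\<bar>) \<le> B" if "x \<in> {c<..d}" for x
  proof -
    have "C * \<bar>x - d\<bar> \<le> \<bar>C\<bar> * (d - c)"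
      using that by (intro mult_mono) auto
    then show ?thesis
      using W[OF that] by (simp add: B_def)
  qed
  obtain S where S: "\<And>s. S \<le> s \<Longrightarrow> B < \<Phi> s"
    using unbounded by blast
  obtain r where r: "r > 0" "\<And>x. x \<in> {0..d} \<Longrightarrow> \<bar>x - c\<bar> < r \<Longrightarrow> \<bar>u x\<bar> < exp (- S)"
    using continuous_on_iff[THEN iffD1, OF cont, rule_format, of c "exp (- S)"] c
    by (auto simp: dist_real_def)
  define x where "x = min (c + r / 2) d"
  have x: "x \<in> {c<..d}" "\<bar>x - c\<bar> < r"
    using r c by (auto simp: x_def min_def)
  then have "\<bar>u x\<bar> < exp (- S)"
    using r(2)[of x] c by auto
  then have "ln \<bar>u x\<bar> < - S"
    using nz[OF x(1)] ln_less_cancel_iff[of "\<bar>u x\<bar>" "exp (- S)"] by simp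
  then show False
    using S[of "- ln \<bar>u x\<bar>"] W'[OF x(1)] by simp
qed

text \<open>
  The modulus condition is the hypothesis of Osgood's lemma for the difference of two
  solutions, as long as this difference is at most one.
\<close>

lemma divergence_imp_unique_solution:
  fixes \<phi> :: "real \<Rightarrow> real"
  assumes pos: "\<And>t. t \<ge> 0 \<Longrightarrow> \<phi> t > 0" and mono: "mono_on {0..} \<phi>"
    and div: "\<not> summable (\<lambda>n. 1 / \<phi> (real (Suc n)))"
    and F: "continuous_on UNIV F" and mod: "modulus_condition \<phi> F"
  shows "has_unique_local_solution F y0"
proof -
  obtain \<beta> \<Phi> where "mono \<beta>" and \<beta>: "\<And>s. 0 < \<beta> s" and \<phi>\<beta>: "\<And>s. 0 \<le> s \<Longrightarrow> \<phi> s \<le> \<beta> s"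
    and \<Phi>: "\<And>s. (\<Phi> has_real_derivative 1 / \<beta> s) (at s)" "\<And>B. \<exists>S. \<forall>s\<ge>S. B < \<Phi> s"
    by (rule continuous_majorant[OF pos mono div]; (assumption | rule that)+)
  obtain \<psi> where \<psi>: "continuous_on UNIV \<psi>" "\<And>x. \<psi> x > 0"
    and Fmod: "\<And>x y z. y < z \<Longrightarrow> z \<le> y + 1 \<Longrightarrow>
           \<bar>F (x, y) - F (x, z)\<bar> < (z - y) * \<psi> x * \<phi> \<bar>ln (z - y)\<bar>"
    using mod unfolding modulus_condition_def by blast
  have osgood: "\<bar>F (x, z) - F (x, y)\<bar> \<le> \<psi> x * (\<bar>z - y\<bar> * \<beta> (- ln \<bar>z - y\<bar>))"
    if "z \<noteq> y" "\<bar>z - y\<bar> \<le> 1" for x y z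
  proof -
    have *: "\<bar>F (x, z) - F (x, y)\<bar> \<le> \<psi> x * (\<bar>z - y\<bar> * \<beta> (- ln \<bar>z - y\<bar>))"
      if "y < z" "z \<le> y + 1" for y z
    proof -
      have "\<bar>F (x, z) - F (x, y)\<bar> \<le> (z - y) * \<psi> x * \<phi> \<bar>ln (z - y)\<bar>"
        using Fmod[OF that, of x] by (simp add: abs_minus_commute)
      also have "\<dots> \<le> (z - y) * \<psi> x * \<beta> \<bar>ln (z - y)\<bar>"
        using that \<psi>(2)[of x] by (intro mult_left_mono \<phi>\<beta>) auto
      also have "\<bar>ln (z - y)\<bar> = - ln \<bar>z - y\<bar>"
        using that by simp
      finally show ?thesis
        using that by (simp add: mult_ac)
    qed
    show ?thesis
    proof (cases "y < z")
      case True
      then show ?thesis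
        using *[of y z] that by simp
    next
      case False
      then show ?thesis
        using *[of z y] that by (simp add: abs_minus_commute)
    qed
  qed
  have "\<exists>K. open_interval_around_0 K \<and> K \<subseteq> I \<inter> J \<and> (\<forall>x\<in>K. y x = z x)"
    if y: "local_solution F y0 I y" and z: "local_solution F y0 J z" for I J y z
  proof -
    have IJ: "open (I \<inter> J)" "0 \<in> I \<inter> J" and yz0: "y 0 = z 0"
      and yd: "\<And>x. x \<in> I \<Longrightarrow> (y has_real_derivative F (x, y x)) (at x)"
      and zd: "\<And>x. x \<in> J \<Longrightarrow> (z has_real_derivative F (x, z x)) (at x)"
      using y z by (auto simp: local_solution_def solves_ivp_on_def open_interval_around_0_def)
    obtain e where e: "e > 0" "cball 0 e \<subseteq> I \<inter> J"
      using IJ open_contains_cball by blast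
    have "isCont (\<lambda>x. z x - y x) 0"
      using IJ yd zd by (intro continuous_intros) (auto intro: DERIV_isCont)
    from continuous_at_eps_delta[THEN iffD1, OF this, rule_format, of 1] obtain r
      where r: "r > 0" "\<And>x. \<bar>x\<bar> < r \<Longrightarrow> \<bar>z x - y x\<bar> < 1"
      using yz0 by auto
    define K where "K = {- min e r<..<min e r}"
    have K: "x \<in> I" "x \<in> J" "\<bar>z x - y x\<bar> < 1" if "x \<in> K" for x
    proof -
      have "x \<in> cball 0 e"
        using that by (auto simp: K_def dist_real_def)
      then show "x \<in> I" "x \<in> J"
        using e(2) by auto
      show "\<bar>z x - y x\<bar> < 1"
        using that by (intro r(2)) (auto simp: K_def)
    qed
    \<comment> \<open>The sign \<open>\<sigma>\<close> treats both time directions at once: \<open>\<sigma> = 1\<close> is the future, \<open>\<sigma> = -1\<close> the past.\<close>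
    have vanish: "z (\<sigma> * d) - y (\<sigma> * d) = 0" if \<sigma>: "\<bar>\<sigma>\<bar> = 1" and d: "0 \<le> d" "d < min e r" for \<sigma> d
    proof -
      have in_K: "\<sigma> * t \<in> K" if "t \<in> {0..d}" for t
      proof -
        have "\<bar>\<sigma> * t\<bar> < min e r"
          using that d \<sigma> by (simp add: abs_mult)
        then show ?thesis
          by (auto simp: K_def abs_less_iff)
      qed
      obtain C where C: "0 \<le> C" "\<And>x. x \<in> {- e..e} \<Longrightarrow> \<bar>\<psi> x\<bar> \<le> C"
        using continuous_imp_bounded_on_interval[OF \<psi>(1)] by metis
      show ?thesis
      proof (rule Osgood_vanishing[OF \<beta> \<Phi> d(1)])
        show "z (\<sigma> * 0) - y (\<sigma> * 0) = 0"
          using yz0 by simp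
        fix t assume t: "t \<in> {0..d}"
        let ?x = "\<sigma> * t"
        have "((\<lambda>t. z (\<sigma> * t)) has_real_derivative F (?x, z ?x) * \<sigma>) (at t within {0..d})"
          by (rule DERIV_chain2[where f = z]) (auto intro!: zd K in_K[OF t] derivative_eq_intros)
        moreover have "((\<lambda>t. y (\<sigma> * t)) has_real_derivative F (?x, y ?x) * \<sigma>) (at t within {0..d})"
          by (rule DERIV_chain2[where f = y]) (auto intro!: yd K in_K[OF t] derivative_eq_intros)
        ultimately show "((\<lambda>t. z (\<sigma> * t) - y (\<sigma> * t)) has_real_derivative
            F (?x, z ?x) * \<sigma> - F (?x, y ?x) * \<sigma>) (at t within {0..d})"
          by (rule DERIV_diff)
        assume ne: "z ?x - y ?x \<noteq> 0"
        have "\<bar>F (?x, z ?x) * \<sigma> - F (?x, y ?x) * \<sigma>\<bar> = \<bar>F (?x, z ?x) - F (?x, y ?x)\<bar>"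
          using \<sigma> by (simp add: abs_mult flip: left_diff_distrib)
        also have "\<dots> \<le> \<psi> ?x * (\<bar>z ?x - y ?x\<bar> * \<beta> (- ln \<bar>z ?x - y ?x\<bar>))"
          using ne K(3)[OF in_K[OF t]] by (intro osgood) auto
        also have "\<dots> \<le> C * (\<bar>z ?x - y ?x\<bar> * \<beta> (- ln \<bar>z ?x - y ?x\<bar>))"
        proof (rule mult_right_mono)
          have "?x \<in> {- e..e}"
            using in_K[OF t] by (auto simp: K_def)
          from C(2)[OF this] show "\<psi> ?x \<le> C"
            by simp
          show "0 \<le> \<bar>z ?x - y ?x\<bar> * \<beta> (- ln \<bar>z ?x - y ?x\<bar>)"
            by (intro mult_nonneg_nonneg less_imp_le[OF \<beta>]) simp
        qed
        finally show "\<bar>F (?x, z ?x) * \<sigma> - F (?x, y ?x) * \<sigma>\<bar>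
            \<le> C * (\<bar>z ?x - y ?x\<bar> * \<beta> (- ln \<bar>z ?x - y ?x\<bar>))" .
      qed
    qed
    have "y x = z x" if "x \<in> K" for x
      using vanish[of 1 x] vanish[of "-1" "- x"] that
      by (cases "0 \<le> x") (auto simp: K_def minus_less_iff[of "min e r" x])
    moreover have "open_interval_around_0 K"
      using e r by (auto simp: open_interval_around_0_def K_def is_interval_1)
    ultimately show ?thesis
      using K by blast
  qed
  then show ?thesis
    unfolding has_unique_local_solution_def using Peano_local_existence[OF F] by metis
qed

text \<open>
  The growth condition bounds the speed of \<open>ln (2 + \<bar>y\<bar>)\<close> by \<open>\<psi> * \<beta>\<close>, which suggests the Lyapunov
  function \<open>\<Phi> (ln (2 + \<bar>y\<bar>))\<close>. Replacing \<open>2 + \<bar>y\<bar>\<close> by the larger \<open>4 + y\<^sup>2\<close> makes it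
  differentiable at \<open>0\<close> and costs only a factor two.
\<close>

lemma divergence_imp_Lyapunov:
  fixes \<phi> :: "real \<Rightarrow> real"
  assumes pos: "\<And>t. t \<ge> 0 \<Longrightarrow> \<phi> t > 0" and mono: "mono_on {0..} \<phi>"
    and div: "\<not> summable (\<lambda>n. 1 / \<phi> (real (Suc n)))"
    and growth: "growth_condition \<phi> F"
  shows "has_Lyapunov_function F"
proof -
  obtain \<beta> \<Phi> where "mono \<beta>" and \<beta>: "\<And>s. 0 < \<beta> s" and \<phi>\<beta>: "\<And>s. 0 \<le> s \<Longrightarrow> \<phi> s \<le> \<beta> s"
    and \<Phi>: "\<And>s. (\<Phi> has_real_derivative 1 / \<beta> s) (at s)" "\<And>B. \<exists>S. \<forall>s\<ge>S. B < \<Phi> s"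
    by (rule continuous_majorant[OF pos mono div]; (assumption | rule that)+)
  obtain \<psi> where \<psi>: "continuous_on UNIV \<psi>" "\<And>x. \<psi> x > 0"
    and FG: "\<And>x y. y \<noteq> 0 \<Longrightarrow> \<bar>F (x, y)\<bar> < \<bar>y\<bar> * \<psi> x * \<phi> (ln (2 + \<bar>y\<bar>))"
    using growth unfolding growth_condition_def by blast
  let ?s = "\<lambda>y::real. ln (4 + y\<^sup>2)"
  have abs_le: "\<bar>y\<bar> \<le> 1 + y\<^sup>2" for y :: real
    using zero_le_power2[of "\<bar>y\<bar> - 1"] zero_le_power2[of y] by (simp add: power2_diff)
  have s_pos: "0 < 4 + y\<^sup>2" for y :: real
    using zero_le_power2[of y] by linarith
  define V' where "V' = (\<lambda>y. 1 / \<beta> (?s y) * (2 * y / (4 + y\<^sup>2)))"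
  have "((\<lambda>y. \<Phi> (?s y)) has_real_derivative V' y) (at y)" for y
    unfolding V'_def
    by (rule DERIV_chain2[OF \<Phi>(1)]) (use s_pos[of y] in \<open>auto intro!: derivative_eq_intros\<close>)
  moreover have "\<exists>R. \<forall>y. \<Phi> (?s y) \<le> B \<longrightarrow> \<bar>y\<bar> \<le> R" for B
  proof -
    obtain S where S: "\<And>s. S \<le> s \<Longrightarrow> B < \<Phi> s"
      using \<Phi>(2) by blast
    have "\<bar>y\<bar> \<le> exp S" if "\<Phi> (?s y) \<le> B" for y
    proof -
      have "?s y < S"
        using S[of "?s y"] that by linarith
      then have "4 + y\<^sup>2 < exp S"
        using s_pos[of y] by (metis exp_less_cancel_iff exp_ln)
      then show ?thesis
        using abs_le[of y] by linarith
    qed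
    then show ?thesis
      by blast
  qed
  moreover have "\<bar>V' y * F (x, y)\<bar> \<le> 2 * \<psi> x" for x y
  proof (cases "y = 0")
    case True
    then show ?thesis
      using \<psi>(2)[of x] by (simp add: V'_def)
  next
    case False
    have "2 + \<bar>y\<bar> \<le> 4 + y\<^sup>2"
      using abs_le[of y] by simp
    then have "\<phi> (ln (2 + \<bar>y\<bar>)) \<le> \<beta> (?s y)"
      using \<phi>\<beta>[of "ln (2 + \<bar>y\<bar>)"] monoD[OF \<open>mono \<beta>\<close>, of "ln (2 + \<bar>y\<bar>)" "?s y"] by simp
    then have "\<bar>y\<bar> * \<psi> x * \<phi> (ln (2 + \<bar>y\<bar>)) \<le> \<bar>y\<bar> * \<psi> x * \<beta> (?s y)"
      using \<psi>(2)[of x] by (intro mult_left_mono) auto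
    then have "\<bar>F (x, y)\<bar> \<le> \<bar>y\<bar> * \<psi> x * \<beta> (?s y)"
      using FG[OF False, of x] by linarith
    then have "\<bar>V' y\<bar> * \<bar>F (x, y)\<bar> \<le> \<bar>V' y\<bar> * (\<bar>y\<bar> * \<psi> x * \<beta> (?s y))"
      by (rule mult_left_mono) simp
    also have "\<dots> = (2 * y\<^sup>2 / (4 + y\<^sup>2)) * \<psi> x"
      using \<beta>[of "?s y"] s_pos[of y] 
      by (simp add: V'_def abs_mult abs_divide power2_eq_square)
    also have "\<dots> \<le> 2 * \<psi> x"
      using \<psi>(2)[of x] s_pos[of y] by (intro mult_right_mono) (auto simp: pos_divide_le_eq)
    finally show ?thesis
      by (simp add: abs_mult)
  qed
  moreover have "continuous_on UNIV (\<lambda>x. 2 * \<psi> x)"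
    by (intro continuous_intros \<psi>)
  ultimately show ?thesis
    unfolding has_Lyapunov_function_def
    by (intro exI[of _ "\<lambda>y. \<Phi> (?s y)"] exI[of _ V'] exI[of _ "\<lambda>x. 2 * \<psi> x"]) blast
qed

section \<open>Convergent series: blow-up and branching\<close>

text \<open>
  For \<open>y' = \<bar>y\<bar> * \<alpha> (ln (2 + \<bar>y\<bar>))\<close> with \<open>y 0 = 1\<close> the solution increases, and
  \<open>Q (ln (2 + y))\<close> grows at a rate \<open>y / (2 + y) \<ge> 1 / 3\<close>, although it is bounded by \<open>B\<close>.
\<close>

lemma convergence_imp_blow_up:
  fixes \<phi> :: "real \<Rightarrow> real"
  assumes pos: "\<And>t. t \<ge> 0 \<Longrightarrow> \<phi> t > 0" and mono: "mono_on {0..} \<phi>"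
    and conv: "summable (\<lambda>n. 1 / \<phi> (real (Suc n)))"
  obtains F where "continuous_on UNIV F" "growth_condition \<phi> F" "\<And>Y. \<not> global_solution F 1 Y"
proof -
  obtain \<alpha> Q B where \<alpha>: "continuous_on UNIV \<alpha>" "mono \<alpha>" "\<And>s. 0 < \<alpha> s" "\<And>s. 0 \<le> s \<Longrightarrow> \<alpha> s \<le> \<phi> s"
    and Q: "\<And>s. (Q has_real_derivative 1 / \<alpha> s) (at s)" "\<And>s. Q s \<le> B"
    by (rule continuous_minorant[OF pos mono conv]; (assumption | rule that)+)
  define F where "F = (\<lambda>p::real \<times> real. \<bar>snd p\<bar> * \<alpha> (ln (2 + \<bar>snd p\<bar>)))"
  have "continuous_on UNIV F"
    unfolding F_def by (intro continuous_intros continuous_on_compose2[OF \<alpha>(1)]) auto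
  moreover have "growth_condition \<phi> F"
    unfolding growth_condition_def
  proof (intro exI[of _ "\<lambda>_. 2"] conjI allI impI)
    fix x y :: real assume "y \<noteq> 0"
    have "\<alpha> (ln (2 + \<bar>y\<bar>)) < 2 * \<phi> (ln (2 + \<bar>y\<bar>))"
      using \<alpha>(4)[of "ln (2 + \<bar>y\<bar>)"] pos[of "ln (2 + \<bar>y\<bar>)"] by simp
    then have "\<bar>y\<bar> * \<alpha> (ln (2 + \<bar>y\<bar>)) < \<bar>y\<bar> * (2 * \<phi> (ln (2 + \<bar>y\<bar>)))"
      using \<open>y \<noteq> 0\<close> by (intro mult_strict_left_mono) auto
    then show "\<bar>F (x, y)\<bar> < \<bar>y\<bar> * 2 * \<phi> (ln (2 + \<bar>y\<bar>))"
      using \<alpha>(3)[of "ln (2 + \<bar>y\<bar>)"] by (simp add: F_def abs_mult)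
  qed auto
  moreover have "\<not> global_solution F 1 Y" for Y
  proof
    assume "global_solution F 1 Y"
    then have Y0: "Y 0 = 1" and Y: "\<And>x. (Y has_real_derivative F (x, Y x)) (at x)"
      by (auto simp: global_solution_def solves_ivp_on_def)
    have "0 \<le> F p" for p
      unfolding F_def by (intro mult_nonneg_nonneg less_imp_le[OF \<alpha>(3)]) simp
    then have Y1: "1 \<le> Y x" if "0 \<le> x" for x
      using DERIV_nonneg_imp_nondecreasing[OF that, of Y] Y Y0 by metis
    define W where "W = (\<lambda>x. Q (ln (2 + Y x)) - x / 3)"
    have W: "W 0 \<le> W x" if "0 \<le> x" for x
    proof (rule DERIV_nonneg_imp_nondecreasing[OF that])
      fix t assume t: "0 \<le> t" "t \<le> x"
      have Yt: "1 \<le> Y t"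
        using Y1 t by simp
      have "((\<lambda>x. ln (2 + Y x)) has_real_derivative F (t, Y t) / (2 + Y t)) (at t)"
        using Yt by (auto intro!: derivative_eq_intros Y)
      then have "((\<lambda>x. Q (ln (2 + Y x))) has_real_derivative
          1 / \<alpha> (ln (2 + Y t)) * (F (t, Y t) / (2 + Y t))) (at t)"
        by (rule DERIV_chain2[OF Q(1)])
      then have "(W has_real_derivative 1 / \<alpha> (ln (2 + Y t)) * (F (t, Y t) / (2 + Y t)) - 1 / 3) (at t)"
        unfolding W_def by (rule DERIV_diff) (auto intro!: derivative_eq_intros)
      moreover have "1 / \<alpha> (ln (2 + Y t)) * (F (t, Y t) / (2 + Y t)) = Y t / (2 + Y t)"
        using Yt \<alpha>(3)[of "ln (2 + Y t)"] by (simp add: F_def)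
      moreover have "1 / 3 \<le> Y t / (2 + Y t)"
        using Yt by (simp add: field_simps)
      ultimately show "\<exists>D. (W has_real_derivative D) (at t) \<and> 0 \<le> D"
        by (metis diff_ge_0_iff_ge)
    qed
    have "W 0 \<le> B - x / 3" if "0 \<le> x" for x
      using W[OF that] Q(2)[of "ln (2 + Y x)"] by (simp add: W_def)
    from this[of "3 * (\<bar>B - W 0\<bar> + 1)"] show False
      by (simp add: add_divide_distrib abs_if split: if_splits)
  qed
  ultimately show thesis
    by (rule that)
qed

text \<open>
  If \<open>r u / u\<close> is nonincreasing, then \<open>r\<close> is subadditive, and a nondecreasing
  subadditive function is its own modulus of continuity.
\<close>

lemma star_shaped_modulus:
  fixes r :: "real \<Rightarrow> real"
  assumes zero: "\<And>u. u \<le> 0 \<Longrightarrow> r u = 0"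
    and mono: "\<And>u v. \<lbrakk>u \<le> v; v \<le> 1\<rbrakk> \<Longrightarrow> r u \<le> r v"
    and ratio: "\<And>u v. \<lbrakk>0 < u; u \<le> v; v \<le> 1\<rbrakk> \<Longrightarrow> r v / v \<le> r u / u"
    and yz: "y \<le> z" "z \<le> 1" "z - y \<le> 1"
  shows "\<bar>r y - r z\<bar> \<le> r (z - y)"
proof (cases "0 < y \<and> y < z")
  case True
  have "r z = y * (r z / z) + (z - y) * (r z / z)"
    using True by (simp add: field_simps)
  also have "y * (r z / z) + (z - y) * (r z / z) \<le> y * (r y / y) + (z - y) * (r (z - y) / (z - y))"
    using True yz by (intro add_mono mult_left_mono ratio) auto
  also have "\<dots> = r y + r (z - y)"
    using True by simp
  finally show ?thesis
    using mono[OF yz(1,2)] by simp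
next
  case False
  have "r z \<le> r (z - y)" if "y \<le> 0"
    using that yz by (intro mono) auto
  then show ?thesis
    using False yz mono[OF yz(1,2)] zero[of y] zero[of 0] by (cases "y = z") auto
qed

text \<open>
  The counterexample is \<open>y' = g y\<close>, where \<open>g u = u / h (- ln u)\<close> on \<open>{0<..1}\<close>. In the variable
  \<open>s = - ln y\<close> this equation reads \<open>h s * s' = - 1\<close>, so \<open>y\<close> can leave \<open>0\<close> in finite time if \<open>h\<close> is
  integrable. The obvious choice \<open>h = 1 / \<alpha>\<close> is integrable, but then \<open>g\<close> need not be
  monotone, nor tend to \<open>0\<close> at \<open>0\<close> when \<open>\<alpha>\<close> grows fast. Therefore \<open>h\<close> is an exponential average of
  \<open>1 / \<alpha>\<close> over the past, the solution of \<open>h' = 1 / \<alpha> - h / 2\<close> with \<open>h 0 = 2 / \<alpha> 0\<close>. It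
  stays integrable, it is nonincreasing, which makes \<open>g u / u\<close> nonincreasing in \<open>u\<close>, and
  \<open>exp (s / 2) * h s\<close> is nondecreasing, which makes \<open>g\<close> nondecreasing and bounds it by a
  multiple of \<open>sqrt u\<close>.
\<close>

lemma convergence_imp_nonunique:
  fixes \<phi> :: "real \<Rightarrow> real"
  assumes pos: "\<And>t. t \<ge> 0 \<Longrightarrow> \<phi> t > 0" and mono: "mono_on {0..} \<phi>"
    and conv: "summable (\<lambda>n. 1 / \<phi> (real (Suc n)))"
  obtains F where "continuous_on UNIV F" "modulus_condition \<phi> F" "\<not> has_unique_local_solution F 0"
proof -
  obtain \<alpha> Q B where \<alpha>: "continuous_on UNIV \<alpha>" and \<alpha>mono: "mono \<alpha>" and \<alpha>pos: "\<And>s. 0 < \<alpha> s"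
    and \<alpha>\<phi>: "\<And>s. 0 \<le> s \<Longrightarrow> \<alpha> s \<le> \<phi> s"
    and Q: "\<And>s. (Q has_real_derivative 1 / \<alpha> s) (at s)" "\<And>s. Q s \<le> B"
    by (rule continuous_minorant[OF pos mono conv]; (assumption | rule that)+)
  have \<alpha>nz: "\<alpha> s \<noteq> 0" for s
    using \<alpha>pos[of s] by simp
  have "continuous_on UNIV (\<lambda>s. exp (s / 2) / \<alpha> s)"
    using \<alpha>nz by (intro continuous_intros \<alpha>) auto
  then obtain K where K: "\<And>s. (K has_real_derivative exp (s / 2) / \<alpha> s) (at s)"
    using antiderivative_exists by blast
  define k where "k = (\<lambda>s. K s - K 0 + 2 / \<alpha> 0)"
  define h where "h = (\<lambda>s. exp (- (s / 2)) * k s)"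
  \<comment> \<open>An antiderivative of \<open>h\<close>, by the differential equation for \<open>h\<close>; it is bounded above, which is
    the integrability of \<open>h\<close>.\<close>
  define H where "H = (\<lambda>s. 2 * Q s - 2 * h s)"
  have k: "(k has_real_derivative exp (s / 2) / \<alpha> s) (at s)" for s
    unfolding k_def by (auto intro!: derivative_eq_intros K)
  have h: "(h has_real_derivative 1 / \<alpha> s - h s / 2) (at s)" for s
    unfolding h_def by (auto intro!: derivative_eq_intros k simp: field_simps exp_minus)
  have H: "(H has_real_derivative h s) (at s)" for s
    unfolding H_def by (auto intro!: derivative_eq_intros Q h)
  have k_mono: "k s \<le> k t" if "s \<le> t" for s t
  proof (rule DERIV_nonneg_imp_nondecreasing[OF that])
    fix x
    have "0 \<le> exp (x / 2) / \<alpha> x"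
      using \<alpha>pos[of x] by simp
    then show "\<exists>D. (k has_real_derivative D) (at x) \<and> 0 \<le> D"
      using k by blast
  qed
  have k_pos: "2 / \<alpha> 0 \<le> k s" if "0 \<le> s" for s
    using k_mono[OF that] by (simp add: k_def)
  have k_pos': "0 < k s" if "0 \<le> s" for s
    using k_pos[OF that] \<alpha>pos[of 0] by (smt (verit) divide_pos_pos)
  have h_lower: "2 / \<alpha> s \<le> h s" if s: "0 \<le> s" for s
  proof -
    \<comment> \<open>Freezing \<open>\<alpha>\<close> at its value at \<open>s\<close>, the maximum on \<open>{0..s}\<close>, can only decrease the derivative of \<open>k\<close>.\<close>
    have "k 0 - 2 * exp (0 / 2) / \<alpha> s \<le> k s - 2 * exp (s / 2) / \<alpha> s"
    proof (rule DERIV_nonneg_imp_nondecreasing[OF s])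
      fix t assume t: "0 \<le> t" "t \<le> s"
      have "((\<lambda>t. k t - 2 * exp (t / 2) / \<alpha> s) has_real_derivative
              exp (t / 2) / \<alpha> t - exp (t / 2) / \<alpha> s) (at t)"
        using \<alpha>nz by (auto intro!: derivative_eq_intros k)
      moreover have "exp (t / 2) / \<alpha> s \<le> exp (t / 2) / \<alpha> t"
        using \<alpha>pos monoD[OF \<alpha>mono t(2)] by (intro divide_left_mono) auto
      ultimately show "\<exists>D. ((\<lambda>t. k t - 2 * exp (t / 2) / \<alpha> s) has_real_derivative D) (at t) \<and> 0 \<le> D"
        by (metis diff_ge_0_iff_ge)
    qed
    moreover have "2 / \<alpha> s \<le> 2 / \<alpha> 0"
      using \<alpha>pos monoD[OF \<alpha>mono s] by (intro divide_left_mono) auto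
    ultimately have "2 * exp (s / 2) / \<alpha> s \<le> k s"
      by (simp add: k_def)
    then have "exp (- (s / 2)) * (2 * exp (s / 2) / \<alpha> s) \<le> h s"
      unfolding h_def by (rule mult_left_mono) simp
    then show ?thesis
      by (simp add: exp_minus field_simps)
  qed
  have h_pos: "0 < h s" if "0 \<le> s" for s
    using k_pos'[OF that] by (simp add: h_def)
  have h_anti: "h t \<le> h s" if "0 \<le> s" "s \<le> t" for s t
  proof (rule DERIV_nonpos_imp_nonincreasing[OF that(2)])
    fix x assume "s \<le> x" "x \<le> t"
    then show "\<exists>D. (h has_real_derivative D) (at x) \<and> D \<le> 0"
      using h[of x] h_lower[of x] that by (intro exI[of _ "1 / \<alpha> x - h x / 2"]) auto
  qed
  have H_bound: "H s \<le> 2 * B" if "0 \<le> s" for s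
    using Q(2)[of s] h_pos[OF that] by (simp add: H_def)

  \<comment> \<open>This is \<open>exp (- s) / h s\<close>, that is, \<open>r\<close> below in the variable \<open>s\<close>.\<close>
  define \<rho> where "\<rho> = (\<lambda>s. exp (- (s / 2)) / k s)"
  define r where "r = (\<lambda>u. if u \<le> 0 then 0 else \<rho> (- ln u))"
  have \<rho>_anti: "\<rho> t \<le> \<rho> s" if "0 \<le> s" "s \<le> t" for s t
    unfolding \<rho>_def using that k_pos' k_mono[OF that(2)] by (intro frac_le) auto
  have \<rho>_pos: "0 < \<rho> s" if "0 \<le> s" for s
    using k_pos'[OF that] by (simp add: \<rho>_def)
  have r_h: "r u = u / h (- ln u)" if "0 < u" for u
  proof -
    have "exp (ln u / 2) * exp (ln u / 2) = u"
      using that by (simp flip: exp_add)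
    then have "u / h (- ln u) = exp (ln u / 2) * exp (ln u / 2) / (exp (ln u / 2) * k (- ln u))"
      by (simp add: h_def)
    also have "\<dots> = r u"
      using that by (simp add: r_def \<rho>_def)
    finally show ?thesis
      by simp
  qed
  have r_zero: "r u = 0" if "u \<le> 0" for u
    using that by (simp add: r_def)
  have r_nonneg: "0 \<le> r u" if "u \<le> 1" for u
    using \<rho>_pos[of "- ln u"] that by (auto simp: r_def intro: less_imp_le)
  have r_mono: "r u \<le> r v" if "u \<le> v" "v \<le> 1" for u v
  proof (cases "0 < u")
    case True
    then show ?thesis
      using that \<rho>_anti[of "- ln v" "- ln u"] by (simp add: r_def)
  next
    case False
    then show ?thesis
      using r_nonneg[OF that(2)] r_zero[of u] by simp
  qed
  have r_ratio: "r v / v \<le> r u / u" if "0 < u" "u \<le> v" "v \<le> 1" for u v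
  proof -
    have "h (- ln u) \<le> h (- ln v)"
      using that by (intro h_anti) auto
    moreover have "0 < h (- ln u)"
      using that by (intro h_pos) auto
    ultimately show ?thesis
      using that by (simp add: r_h frac_le)
  qed
  define g where "g = (\<lambda>y. r (min y 1))"
  have g_nonneg: "0 \<le> g y" for y
    unfolding g_def by (rule r_nonneg) simp
  have g_bound: "\<bar>g y\<bar> \<le> r 1" for y
    using g_nonneg[of y] r_mono[of "min y 1" 1] by (simp add: g_def)
  have g_sqrt: "\<bar>g y\<bar> \<le> \<alpha> 0 / 2 * sqrt \<bar>y\<bar>" for y
  proof (cases "0 < y")
    case True
    define m where "m = min y 1"
    have m: "0 < m" "m \<le> 1" "m \<le> y"
      using True by (auto simp: m_def)
    have "exp (ln m / 2) = sqrt m"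
      using m by (intro real_sqrt_unique[symmetric]) (simp_all add: power2_eq_square flip: exp_add)
    then have "g y = sqrt m / k (- ln m)"
      using m by (simp add: g_def m_def[symmetric] r_def \<rho>_def)
    also have "\<dots> \<le> sqrt m / (2 / \<alpha> 0)"
      using m k_pos[of "- ln m"] k_pos'[of "- ln m"] \<alpha>pos[of 0] by (intro divide_left_mono) auto
    also have "\<dots> = \<alpha> 0 / 2 * sqrt m"
      by simp
    also have "\<dots> \<le> \<alpha> 0 / 2 * sqrt \<bar>y\<bar>"
      using m \<alpha>pos[of 0] by (intro mult_left_mono) auto
    finally show ?thesis
      using g_nonneg[of y] by simp
  next
    case False
    then show ?thesis
      using \<alpha>pos[of 0] by (simp add: g_def r_zero)
  qed
  have g0: "g y = 0" if "y \<le> 0" for y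
    using that by (simp add: g_def r_zero)
  have g_cont: "isCont g y" for y
  proof -
    consider "y < 0" | "y = 0" | "0 < y"
      by linarith
    then show ?thesis
    proof cases
      case 1
      have "\<forall>\<^sub>F z in nhds y. g z = 0"
        using eventually_nhds_in_open[of "{..<0}" y] 1 by (auto elim!: eventually_mono simp: g0)
      then show ?thesis
        by (simp add: isCont_cong[of g "\<lambda>_. 0"])
    next
      case 2
      have "((\<lambda>z. \<alpha> 0 / 2 * sqrt \<bar>z\<bar>) \<longlongrightarrow> \<alpha> 0 / 2 * sqrt \<bar>0\<bar>) (at 0)"
        by (intro tendsto_intros)
      then have "(g \<longlongrightarrow> 0) (at 0)"
        using g_sqrt by (intro Lim_null_comparison[of g "\<lambda>z. \<alpha> 0 / 2 * sqrt \<bar>z\<bar>"]) auto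
      then show ?thesis
        using 2 by (simp add: isCont_def g0)
    next
      case 3
      have "\<forall>\<^sub>F z in nhds y. g z = \<rho> (- ln (min z 1))"
        using eventually_nhds_in_open[of "{0<..}" y] 3
        by (auto elim!: eventually_mono simp: g_def r_def)
      moreover have "isCont (\<lambda>z. \<rho> (- ln (min z 1))) y"
      proof -
        have "isCont \<rho> s" if "0 \<le> s" for s
          unfolding \<rho>_def using DERIV_isCont[OF k[of s]] k_pos'[OF that]
          by (intro continuous_intros) auto
        moreover have "isCont (\<lambda>z. - ln (min z 1)) y"
          using 3 by (intro continuous_intros) auto
        ultimately show ?thesis
          using 3 by (intro isCont_o2[of y "\<lambda>z. - ln (min z 1)" \<rho>]) auto
      qed
      ultimately show ?thesis
        by (simp add: isCont_cong[of g "\<lambda>z. \<rho> (- ln (min z 1))"])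
    qed
  qed
  define F where "F = (\<lambda>p::real \<times> real. g (snd p))"
  have "continuous_on UNIV g"
    using g_cont by (simp add: continuous_on_eq_continuous_at)
  then have F: "continuous_on UNIV F"
    unfolding F_def by (rule continuous_on_compose2) (auto intro: continuous_intros)
  have "modulus_condition \<phi> F"
    unfolding modulus_condition_def
  proof (intro exI[of _ "\<lambda>_. 1"] conjI allI impI)
    fix x y z :: real assume yz: "y < z \<and> z \<le> y + 1"
    define s where "s = - ln (z - y)"
    have s: "0 \<le> s" "\<bar>ln (z - y)\<bar> = s"
      using yz by (auto simp: s_def)
    have "\<bar>g y - g z\<bar> \<le> r (min z 1 - min y 1)"
      unfolding g_def using yz by (intro star_shaped_modulus r_zero r_mono r_ratio) auto
    also have "\<dots> \<le> r (z - y)"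
      using yz by (intro r_mono) auto
    also have "\<dots> = (z - y) / h s"
      using yz by (simp add: r_h s_def)
    also have "\<dots> \<le> (z - y) / (2 / \<alpha> s)"
      using yz h_lower[OF s(1)] h_pos[OF s(1)] \<alpha>pos[of s] by (intro divide_left_mono) auto
    also have "\<dots> < (z - y) * \<phi> s"
    proof -
      have "\<alpha> s / 2 < \<phi> s"
        using \<alpha>\<phi>[OF s(1)] pos[OF s(1)] by simp
      then have "(z - y) * (\<alpha> s / 2) < (z - y) * \<phi> s"
        using yz by (intro mult_strict_left_mono) auto
      then show ?thesis
        by simp
    qed
    finally show "\<bar>F (x, y) - F (x, z)\<bar> < (z - y) * 1 * \<phi> \<bar>ln (z - y)\<bar>"
      using s by (simp add: F_def)
  qed auto
  moreover have "\<not> has_unique_local_solution F 0"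
  proof
    assume unique: "has_unique_local_solution F 0"
    \<comment> \<open>Run the equation backwards from \<open>w 0 = 1\<close>. While \<open>w > 0\<close>, \<open>H (- ln w)\<close> increases with speed one
      and would exceed its bound \<open>2 * B\<close> at time \<open>T\<close>. So \<open>w\<close> reaches \<open>0\<close>, first at time \<open>\<tau>\<close>, and
      its reversal \<open>Y\<close> is a solution through \<open>0\<close> that differs from the zero solution.\<close>
    define T where "T = 2 * B - H 0 + 1"
    have T: "1 \<le> T"
      using H_bound[of 0] by (simp add: T_def)
    have "\<bar>- F p\<bar> \<le> r 1" for p
      using g_bound by (simp add: F_def)
    then obtain w where w0: "w 0 = 1" and w: "solves_on (\<lambda>p. - F p) {0..T} w"
      using bounded_Peano[OF continuous_on_minus[OF F]] by blast
    have w_cont: "continuous_on {0..T} w"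
      using w by (rule solves_on_imp_continuous_on)
    have w_deriv: "(w has_real_derivative - g (w t)) (at t)" if "0 < t" "t < T" for t
    proof -
      have "solves_on (\<lambda>p. - F p) {0<..<T} w"
        by (rule solves_on_subset[OF w]) auto
      then show ?thesis
        using that by (simp add: solves_on_open_iff F_def)
    qed
    have w_le: "w t \<le> 1" if t: "t \<in> {0..T}" for t
    proof -
      have "- w 0 \<le> - w t"
      proof (rule DERIV_nonneg_imp_increasing_open[where f = "\<lambda>t. - w t" and a = 0 and b = t])
        show "continuous_on {0..t} (\<lambda>t. - w t)"
          using t by (intro continuous_intros continuous_on_subset[OF w_cont]) auto
        fix x assume "0 < x" "x < t"
        then have "((\<lambda>t. - w t) has_real_derivative g (w x)) (at x)"
          using w_deriv[of x] t by (auto intro!: derivative_eq_intros)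
        then show "\<exists>D. ((\<lambda>t. - w t) has_real_derivative D) (at x) \<and> 0 \<le> D"
          using g_nonneg by blast
      qed (use t in auto)
      then show ?thesis
        using w0 by simp
    qed
    have "\<exists>t\<in>{0..T}. w t \<le> 0"
    proof (rule ccontr)
      assume "\<not> (\<exists>t\<in>{0..T}. w t \<le> 0)"
      then have w_pos: "0 < w t" if "t \<in> {0..T}" for t
        using that by force
      have "H (- ln (w 0)) - 0 \<le> H (- ln (w T)) - T"
      proof (rule DERIV_nonneg_imp_increasing_open[where f = "\<lambda>t. H (- ln (w t)) - t" and a = 0 and b = T])
        have "continuous_on UNIV H"
          by (intro continuous_at_imp_continuous_on ballI DERIV_isCont[OF H])
        moreover have "continuous_on {0..T} (\<lambda>t. - ln (w t))"
        proof (intro continuous_on_minus continuous_on_ln w_cont ballI)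
          show "w t \<noteq> 0" if "t \<in> {0..T}" for t
            using w_pos[OF that] by simp
        qed
        ultimately have "continuous_on {0..T} (\<lambda>t. H (- ln (w t)))"
          by (rule continuous_on_compose2) simp
        then show "continuous_on {0..T} (\<lambda>t. H (- ln (w t)) - t)"
          by (intro continuous_on_diff continuous_on_id)
        fix x assume x: "0 < x" "x < T"
        have wx: "0 < w x" "w x \<le> 1"
          using w_pos[of x] w_le[of x] x by auto
        have "((\<lambda>t. - ln (w t)) has_real_derivative g (w x) / w x) (at x)"
          using wx w_deriv[OF x] by (auto intro!: derivative_eq_intros)
        from DERIV_chain2[OF H this]
        have "((\<lambda>t. H (- ln (w t)) - t) has_real_derivative h (- ln (w x)) * (g (w x) / w x) - 1) (at x)"
          by (rule DERIV_diff) (rule DERIV_ident)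
        moreover have "h (- ln (w x)) * (g (w x) / w x) = 1"
          using wx h_pos[of "- ln (w x)"] by (simp add: g_def min_absorb1 r_h)
        ultimately show "\<exists>D. ((\<lambda>t. H (- ln (w t)) - t) has_real_derivative D) (at x) \<and> 0 \<le> D"
          by force
      qed (use T in auto)
      moreover have "H (- ln (w T)) \<le> 2 * B"
        using w_pos[of T] w_le[of T] T by (intro H_bound) auto
      ultimately show False
        by (simp add: w0 T_def)
    qed
    then obtain t where t: "t \<in> {0..T}" "w t \<le> 0"
      by blast
    define Z where "Z = {x \<in> {0..T}. w x = 0}"
    have "\<exists>x. 0 \<le> x \<and> x \<le> t \<and> w x = 0"
      using t w0 by (intro IVT2' continuous_on_subset[OF w_cont]) auto
    then obtain x0 where "x0 \<in> Z"
      using t by (force simp: Z_def)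
    then have Z: "closed Z" "Z \<noteq> {}" "bdd_below Z"
      using continuous_closed_preimage_constant[OF w_cont closed_atLeastAtMost, of 0] t
      by (auto simp: Z_def intro: bdd_belowI[of _ 0])
    define \<tau> where "\<tau> = Inf Z"
    have "\<tau> \<in> Z"
      unfolding \<tau>_def using Z by (intro closed_contains_Inf)
    then have \<tau>: "0 < \<tau>" "\<tau> \<le> T" "w \<tau> = 0"
      using w0 by (auto simp: Z_def order_le_less)
    have w_nz: "w x \<noteq> 0" if "0 \<le> x" "x < \<tau>" for x
    proof
      assume "w x = 0"
      then have "x \<in> Z"
        using that \<tau> by (simp add: Z_def)
      then have "\<tau> \<le> x"
        unfolding \<tau>_def using Z(3) by (rule cInf_lower)
      then show False
        using that by simp
    qed
    have rev: "solves_on F {0..\<tau>} (\<lambda>x. w (\<tau> - x))"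
      unfolding solves_on_def
    proof
      fix x assume x: "x \<in> {0..\<tau>}"
      have img: "(\<lambda>x. \<tau> - x) ` {0..\<tau>} \<subseteq> {0..T}"
        using \<tau> by auto
      have "(w has_real_derivative - F (\<tau> - x, w (\<tau> - x))) (at (\<tau> - x) within {0..T})"
        using w x \<tau> by (simp add: solves_on_def)
      then have "(w has_real_derivative - F (\<tau> - x, w (\<tau> - x))) (at (\<tau> - x) within (\<lambda>x. \<tau> - x) ` {0..\<tau>})"
        using img by (rule DERIV_subset)
      moreover have "((\<lambda>x. \<tau> - x) has_real_derivative - 1) (at x within {0..\<tau>})"
        by (auto intro!: derivative_eq_intros)
      ultimately have "(w \<circ> (\<lambda>x. \<tau> - x) has_real_derivative - F (\<tau> - x, w (\<tau> - x)) * - 1)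
          (at x within {0..\<tau>})"
        by (rule DERIV_image_chain)
      then show "((\<lambda>x. w (\<tau> - x)) has_real_derivative F (x, w (\<tau> - x))) (at x within {0..\<tau>})"
        by (simp add: o_def F_def)
    qed
    have zero: "solves_on F S (\<lambda>_. 0)" for S
      by (simp add: solves_on_def F_def g0)
    define Y where "Y = (\<lambda>x. if x \<le> 0 then 0 else w (\<tau> - x))"
    have "solves_on F ({..0} \<union> {0..\<tau>}) Y"
      unfolding Y_def by (rule solves_on_glue[OF zero rev]) (use \<tau> in auto)
    then have "solves_on F {-1<..<\<tau>} Y"
      by (rule solves_on_subset) auto
    then have "local_solution F 0 {-1<..<\<tau>} Y"
      using \<tau> by (simp add: local_solution_def open_interval_around_0_def solves_ivp_on_def
          is_interval_1 solves_on_open_iff Y_def)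
    moreover have "local_solution F 0 UNIV (\<lambda>_. 0)"
      using zero[of UNIV] by (simp add: local_solution_def open_interval_around_0_def
          solves_ivp_on_def solves_on_def)
    ultimately obtain N where N: "open_interval_around_0 N" "\<And>x. x \<in> N \<Longrightarrow> Y x = 0"
      using unique unfolding has_unique_local_solution_def by meson
    then obtain e where e: "e > 0" "ball 0 e \<subseteq> N"
      unfolding open_interval_around_0_def using open_contains_ball by blast
    define x where "x = min (e / 2) (\<tau> / 2)"
    have "x \<in> N" "0 < x" "x < \<tau>"
      using e \<tau> by (auto simp: x_def subset_iff dist_real_def)
    then show False
      using N(2)[of x] w_nz[of "\<tau> - x"] by (simp add: Y_def)
  qed
  ultimately show thesis
    using F by (intro that)
qed

section \<open>Equivalence of divergence, uniqueness and continuation\<close>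

theorem theorem1:
  fixes \<phi> :: "real \<Rightarrow> real"
  assumes "\<And>t. t \<ge> 0 \<Longrightarrow> \<phi> t > 0"
    and "mono_on {0..} \<phi>"
  shows "(\<not> summable (\<lambda>n. 1 / \<phi> (real (Suc n))) \<longleftrightarrow>
           (\<forall>F. continuous_on UNIV F \<longrightarrow> modulus_condition \<phi> F \<longrightarrow>
              (\<forall>y0. has_unique_local_solution F y0)))
       \<and> ((\<forall>F. continuous_on UNIV F \<longrightarrow> modulus_condition \<phi> F \<longrightarrow>
              (\<forall>y0. has_unique_local_solution F y0)) \<longleftrightarrow>
           (\<forall>F. continuous_on UNIV F \<longrightarrow> growth_condition \<phi> F \<longrightarrow>
              (\<forall>y0 I y. local_solution F y0 I y \<longrightarrow>
                 (\<exists>Y. global_solution F y0 Y \<and> (\<forall>x\<in>I. Y x = y x)))))"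
    (is "(\<not> ?conv \<longleftrightarrow> ?uniqueness) \<and> (?uniqueness \<longleftrightarrow> ?continuation)")
proof -
  have 1: "?uniqueness" if div: "\<not> ?conv"
    using divergence_imp_unique_solution[OF assms div] by simp
  have 2: "\<not> ?uniqueness" if conv: "?conv"
  proof
    assume unique: ?uniqueness
    obtain F where F: "continuous_on UNIV F" "modulus_condition \<phi> F" "\<not> has_unique_local_solution F 0"
      by (rule convergence_imp_nonunique[OF assms conv]; (assumption | rule that)+)
    from F(3) unique[rule_format, OF F(1,2)] show False
      by contradiction
  qed
  have 3: "?continuation" if div: "\<not> ?conv"
  proof (intro allI impI)
    fix F y0 I y
    assume F: "continuous_on UNIV F" and growth: "growth_condition \<phi> F" and y: "local_solution F y0 I y"
    obtain Y where "global_solution F y0 Y" "\<And>x. x \<in> I \<Longrightarrow> Y x = y x"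
      using Lyapunov_continuation[OF F divergence_imp_Lyapunov[OF assms div growth] y] by blast
    then show "\<exists>Y. global_solution F y0 Y \<and> (\<forall>x\<in>I. Y x = y x)"
      by blast
  qed
  have 4: "\<not> ?continuation" if conv: "?conv"
  proof
    assume continuation: ?continuation
    obtain F where F: "continuous_on UNIV F" "growth_condition \<phi> F" "\<And>Y. \<not> global_solution F 1 Y"
      by (rule convergence_imp_blow_up[OF assms conv]; (assumption | rule that)+)
    obtain I y where y: "local_solution F 1 I y"
      using Peano_local_existence[OF F(1)] by blast
    from continuation[rule_format, OF F(1,2) y] F(3) show False
      by blast
  qed
  have "(\<not> C \<longleftrightarrow> U) \<and> (U \<longleftrightarrow> K)"
    if "\<not> C \<Longrightarrow> U" "C \<Longrightarrow> \<not> U" "\<not> C \<Longrightarrow> K" "C \<Longrightarrow> \<not> K" for C U K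
    using that by blast
  from this[OF 1 2 3 4] show ?thesis .
qed

end
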